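(* Define integers $b_9(n)$ by $\sum_{n\ge 0} b_9(n)q^n = \prod_{i\ge 1}\frac{1-q^{9i}}{1-q^{i}}$. Let $p\in\{17,19,37\}$, let $\alpha$ be the integer with $0<\alpha<2p$ and $3\alpha\equiv -1 \pmod{2p}$, and let $\beta=\lfloor 2p/3\rfloor$. Then, coefficientwise modulo $2$, $$\sum_{n=0}^\infty b_9(2pn+\alpha)\,q^n \equiv q^{\beta}\sum_{n=0}^\infty b_9(2n+1)\,q^{pn} \pmod 2.$$
   Context: A congruence between power series modulo $2$ means all corresponding coefficients are congruent modulo $2$. For example, for $p=19$ one has $\alpha=25$, $\beta=12$. *)

theory Defs
  imports "HOL-Analysis.Analysis" "HOL-Number_Theory.Cong"
begin

text \<open>
  The quotients are formed over the field of rationals, since division of formal power series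
  is not available over the integers. The product ranges over all i \<ge> 1, hence the shifted index;
  the limit is taken in the topology of coefficientwise stabilisation.
\<close>

definition b9_gf :: "rat fps" where
  "b9_gf = (\<Prod>i. (1 - fps_X ^ (9 * Suc i)) / (1 - fps_X ^ Suc i))"

definition b9 :: "nat \<Rightarrow> int" where
  "b9 n = (THE k. of_int k = fps_nth b9_gf n)"

definition fps_cong :: "int fps \<Rightarrow> int fps \<Rightarrow> int \<Rightarrow> bool" where
  "fps_cong F G m \<longleftrightarrow> (\<forall>n. [fps_nth F n = fps_nth G n] (mod m))"

text \<open>The infinite product converges and its coefficients are the integers \<^const>\<open>b9\<close>.\<close>

theorem has_prod_b9:
  "(\<lambda>i. (1 - fps_X ^ (9 * Suc i)) / (1 - fps_X ^ Suc i)) has_prod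
     Abs_fps (\<lambda>n. rat_of_int (b9 n))"
proof -
  define g :: "nat \<Rightarrow> int fps" where "g = (\<lambda>i. \<Sum>j<9. fps_X ^ (Suc i * j))"
  define h :: "int fps \<Rightarrow> rat fps" where "h = (\<lambda>F. Abs_fps (\<lambda>n. of_int (fps_nth F n)))"
  have h_nth [simp]: "fps_nth (h F) n = of_int (fps_nth F n)" for F n
    by (simp add: h_def)
  have h_mult: "h (F * G) = h F * h G" for F G
    by (rule fps_ext) (simp add: fps_mult_nth)
  have h_1: "h 1 = 1"
    by (rule fps_ext) (simp add: fps_one_nth)
  have h_diff: "h (F - G) = h F - h G" for F G
    by (rule fps_ext) simp
  have h_X: "h (fps_X ^ k) = fps_X ^ k" for k
    by (rule fps_ext) (simp add: fps_X_power_nth)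
  have h_prod: "h (prod F A) = (\<Prod>k\<in>A. h (F k))" if "finite A" for A :: "nat set" and F
    using that by (induction A rule: finite_induct) (simp_all add: h_1 h_mult)
  have g_split: "g i = 1 + (\<Sum>j\<in>{1..<9}. fps_X ^ (Suc i * j))" for i
    unfolding g_def lessThan_atLeast0 by (subst sum.atLeast_Suc_lessThan) auto
  have g_nth_0: "fps_nth (g i) 0 = 1" for i
    unfolding g_split by (simp add: fps_sum_nth fps_X_power_nth)
  have g_nz: "g i \<noteq> 0" for i
    using g_nth_0[of i] by auto
  have g_low: "fps_nth (g k) m = (if m = 0 then 1 else 0)" if "m \<le> n" "k > n" for k m n
  proof -
    have "fps_nth (fps_X ^ (Suc k * j) :: int fps) m = 0" if j: "j \<in> {1..<9}" for j
    proof -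
      have "Suc k * 1 \<le> Suc k * j" using j by (intro mult_le_mono2) auto
      moreover have "m < Suc k * 1" using \<open>m \<le> n\<close> \<open>k > n\<close> by simp
      ultimately have "m \<noteq> Suc k * j" by (metis less_le_not_le)
      thus ?thesis by (simp add: fps_X_power_nth)
    qed
    thus ?thesis unfolding g_split by (simp add: fps_sum_nth fps_one_nth)
  qed
  define c where "c = Abs_fps (\<lambda>n. fps_nth (\<Prod>k\<le>n. g k) n)"
  have stab: "fps_nth (\<Prod>k\<le>N. g k) m = fps_nth (\<Prod>k\<le>n. g k) m" if "m \<le> n" "N \<ge> n" for N m n
    using that(2)
  proof (induction N rule: dec_induct)
    case (step N)
    have "fps_nth ((\<Prod>k\<le>N. g k) * g (Suc N)) m =
          (\<Sum>i=0..m. fps_nth (\<Prod>k\<le>N. g k) i * fps_nth (g (Suc N)) (m - i))"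
      by (simp add: fps_mult_nth)
    also have "\<dots> = (\<Sum>i=0..m. if i = m then fps_nth (\<Prod>k\<le>N. g k) i else 0)"
      by (intro sum.cong refl, subst g_low[where n = n])
         (use that(1) step.hyps in auto)
    also have "\<dots> = fps_nth (\<Prod>k\<le>N. g k) m" by simp
    finally show ?case using step.IH by simp
  qed auto
  have hg: "h (g i) = (1 - fps_X ^ (9 * Suc i)) / (1 - fps_X ^ Suc i)" (is "_ = ?q i") for i
  proof -
    have "(1 - fps_X ^ Suc i) * g i = 1 - (fps_X ^ Suc i) ^ 9"
      unfolding g_def power_mult by (rule one_diff_power_eq [symmetric])
    hence "h ((1 - fps_X ^ Suc i) * g i) = h (1 - fps_X ^ (9 * Suc i))"
      by (simp only: power_mult [symmetric] mult.commute)
    hence *: "(1 - fps_X ^ Suc i) * h (g i) = 1 - fps_X ^ (9 * Suc i)"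
      by (simp only: h_mult h_diff h_1 h_X)
    have "fps_nth (1 - fps_X ^ Suc i :: rat fps) 0 = 1"
      by (simp add: fps_X_power_nth)
    hence "(1 - fps_X ^ Suc i :: rat fps) \<noteq> 0"
      by auto
    thus ?thesis
      unfolding * [symmetric] by (metis nonzero_mult_div_cancel_left)
  qed
  have lim: "(\<lambda>n. \<Prod>k\<le>n. ?q k) \<longlonglongrightarrow> h c"
  proof (rule tendsto_fpsI)
    fix n
    show "eventually (\<lambda>N. fps_nth (\<Prod>k\<le>N. ?q k) n = fps_nth (h c) n) at_top"
      using eventually_ge_at_top[of n]
    proof eventually_elim
      case (elim N)
      have "(\<Prod>k\<le>N. ?q k) = h (\<Prod>k\<le>N. g k)"
        by (simp only: hg h_prod finite_atMost)
      thus ?case using stab[of n n N] elim by (simp add: c_def)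
    qed
  qed
  have "fps_nth (h c) 0 = 1"
    by (simp add: c_def g_nth_0)
  hence "h c \<noteq> 0" by (metis fps_zero_nth zero_neq_one)
  with lim have hp: "?q has_prod h c"
    unfolding has_prod_def raw_has_prod_def by simp
  hence gf: "b9_gf = h c"
    unfolding b9_gf_def by (rule has_prod_unique [symmetric])
  have "b9 n = fps_nth c n" for n
    unfolding b9_def gf by simp
  hence "Abs_fps (\<lambda>n. rat_of_int (b9 n)) = h c"
    by (simp add: h_def)
  with hp show ?thesis by (simp only:)
qed

end

theory Submission
  imports Defs "HOL-Library.Z2"
begin

text \<open>
  Everything happens in \<open>F\<^sub>2[[q]]\<close>. Write \<open>f\<^sub>k = \<Prod>\<^sub>i (1 - q\<^bsup>ki\<^esup>)\<close> and \<open>B = f\<^sub>9 / f\<^sub>1\<close> for the generating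
  function of \<open>b\<^sub>9\<close>. The Jacobi triple product gives \<open>f\<^sub>1\<^sup>3 = f\<^sub>3 + q f\<^sub>9\<^sup>3\<close>, from which one computes
  \<open>B' = F\<^sup>2\<close> with \<open>F = f\<^sub>1 f\<^sub>9\<^sup>2 / f\<^sub>3\<close>; in characteristic 2 this says that \<open>F\<close> is the generating
  function of \<open>b\<^sub>9(2n + 1)\<close>.

  Up to the substitution \<open>q \<mapsto> q\<^sup>3\<close>, \<open>F\<close> is an Eisenstein series of weight 1: three instances of
  Kronecker's formula \<open>(\<Sum> \<plusminus>a\<^sup>i b\<^sup>j Q\<^bsup>ij\<^esup>) \<theta>(a) \<theta>(b) = (Q)\<^sup>3 \<theta>(ab)\<close>, with \<open>a, b\<close> powers of \<open>q\<close> and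
  \<open>Q = q\<^bsup>27\<^esup>\<close>, show that modulo 2 the coefficient of \<open>q\<^sup>n\<close> in \<open>F\<close> counts the pairs of integers with
  \<open>de = 3n + 2\<close> and \<open>(d, e)\<close> congruent to \<open>(2, 1)\<close>, \<open>(5, 1)\<close> or \<open>(2, 4)\<close> modulo 9. Call this count
  \<open>c(3n + 2)\<close>. Negative \<open>d, e\<close> are allowed, so for a prime \<open>p \<equiv> \<plusminus>1\<close> modulo 9 one may scale \<open>d\<close> or \<open>e\<close>
  by whichever of \<open>\<plusminus>p\<close> is 1 modulo 9, and inclusion-exclusion yields
  \<open>c(pN) + c(N / p) = 2 c(\<plusminus>N)\<close>. This is the congruence.
\<close>

section \<open>Power series over the field with two elements\<close>

lemma tendsto_mult_fps:
  fixes f g :: "'b \<Rightarrow> 'a :: comm_ring_1 fps"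
  assumes "(f \<longlongrightarrow> F) net" and "(g \<longlongrightarrow> G) net"
  shows "((\<lambda>x. f x * g x) \<longlongrightarrow> F * G) net"
proof (rule tendsto_fpsI)
  fix n
  have "\<forall>\<^sub>F x in net. \<forall>k\<in>{..n}. fps_nth (f x) k = fps_nth F k"
    by (subst eventually_ball_finite_distrib) (use assms(1) in \<open>auto simp: tendsto_fps_iff\<close>)
  moreover have "\<forall>\<^sub>F x in net. \<forall>k\<in>{..n}. fps_nth (g x) k = fps_nth G k"
    by (subst eventually_ball_finite_distrib) (use assms(2) in \<open>auto simp: tendsto_fps_iff\<close>)
  ultimately show "\<forall>\<^sub>F x in net. fps_nth (f x * g x) n = fps_nth (F * G) n"
    by eventually_elim (auto simp: fps_mult_nth intro!: sum.cong)
qed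

lemma tendsto_prod_fps:
  fixes f :: "'i \<Rightarrow> 'b \<Rightarrow> 'a :: comm_ring_1 fps"
  assumes "\<And>i. i \<in> I \<Longrightarrow> (f i \<longlongrightarrow> F i) net"
  shows "((\<lambda>x. \<Prod>i\<in>I. f i x) \<longlongrightarrow> (\<Prod>i\<in>I. F i)) net"
  using assms by (induction I rule: infinite_finite_induct) (auto intro: tendsto_mult_fps)

lemma of_nat_bit: "of_nat n = (if even n then 0 else 1 :: bit)"
  by (induction n) auto

lemma of_nat_bit_eq_iff: "(of_nat m :: bit) = of_nat n \<longleftrightarrow> even m = even n"
  by (simp add: of_nat_bit)

lemma bit_fps_add_self [simp]: "(F :: bit fps) + F = 0"
  by (rule fps_ext) simp

lemma bit_fps_add_self_left [simp]: "(F :: bit fps) + (F + G) = G"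
  by (simp flip: add.assoc)

lemma bit_fps_two [simp]: "(2 :: bit fps) = 0"
  using bit_fps_add_self[of 1] by (simp only: one_add_one)

lemma bit_fps_square_add: "((F :: bit fps) + G) ^ 2 = F ^ 2 + G ^ 2"
  by (simp add: power2_sum)

text \<open>In characteristic 2 the derivative of a square vanishes, so squares behave as
  constants.\<close>

lemma bit_fps_deriv_square_mult: "fps_deriv (F ^ 2 * G) = F ^ 2 * fps_deriv (G :: bit fps)"
proof -
  have "fps_deriv (F ^ 2) = F * fps_deriv F + F * fps_deriv F"
    by (simp only: power2_eq_square fps_deriv_mult mult.commute)
  thus ?thesis by simp
qed

text \<open>The reflection \<open>i \<mapsto> 2 * n - i\<close> pairs off all terms of the Cauchy
  product except the middle one, and \<open>x * x = x\<close> in \<open>bit\<close>.\<close>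

lemma bit_fps_square_nth: "fps_nth ((F :: bit fps) ^ 2) (2 * n) = fps_nth F n"
proof -
  define A where "A = {..2 * n} - {n}"
  have "(\<Sum>i\<in>A. fps_nth F i * fps_nth F (2 * n - i)) = 0" (is "sum ?g A = 0")
  proof -
    have A: "A = {..<n} \<union> {n<..2 * n}" by (auto simp: A_def)
    have "sum ?g A = sum ?g {..<n} + sum ?g {n<..2 * n}"
      unfolding A by (subst sum.union_disjoint) auto
    also have "sum ?g {n<..2 * n} = sum ?g {..<n}"
      by (rule sum.reindex_bij_witness[of _ "\<lambda>i. 2 * n - i" "\<lambda>i. 2 * n - i"])
         (auto simp: mult.commute)
    finally show ?thesis by simp
  qed
  moreover have "fps_nth (F ^ 2) (2 * n) = ?g n + sum ?g A"
    unfolding power2_eq_square fps_mult_nth A_def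
    by (subst atMost_atLeast0, subst sum.remove[of _ n]) auto
  ultimately show ?thesis by (cases "fps_nth F n") auto
qed

text \<open>
  A weight that is attained infinitely often contributes 0 here, since \<^const>\<open>card\<close> of an infinite
  set is 0; the predicate \<open>graded\<close> below excludes this.
\<close>

definition gf :: "'a set \<Rightarrow> ('a \<Rightarrow> int) \<Rightarrow> bit fps" where
  "gf S w = Abs_fps (\<lambda>n. of_nat (card {x \<in> S. w x = int n}))"

definition graded :: "'a set \<Rightarrow> ('a \<Rightarrow> int) \<Rightarrow> bool" where
  "graded S w \<longleftrightarrow> (\<forall>x\<in>S. w x \<ge> 0) \<and> (\<forall>n. finite {x \<in> S. w x = n})"

lemma gf_nth: "fps_nth (gf S w) n = of_nat (card {x \<in> S. w x = int n})"
  by (simp add: gf_def)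

lemma gradedD: "graded S w \<Longrightarrow> x \<in> S \<Longrightarrow> w x \<ge> 0" "graded S w \<Longrightarrow> finite {x \<in> S. w x = n}"
  by (auto simp: graded_def)

lemma gradedI:
  assumes "\<And>x. x \<in> S \<Longrightarrow> w x \<ge> 0" "\<And>n. finite {x \<in> S. w x = n}"
  shows "graded S w"
  using assms by (simp add: graded_def)
lemma graded_Times:
  assumes "graded S v" "graded T w"
  shows "graded (S \<times> T) (\<lambda>(x, y). v x + w y)"
proof (rule gradedI)
  show "(case z of (x, y) \<Rightarrow> v x + w y) \<ge> 0" if "z \<in> S \<times> T" for z
    using that gradedD(1)[OF assms(1)] gradedD(1)[OF assms(2)] by auto
  fix n
  let ?B = "\<Union>k\<in>{0..n}. {x \<in> S. v x = k} \<times> {y \<in> T. w y = n - k}"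
  have "finite ?B"
    using gradedD(2)[OF assms(1)] gradedD(2)[OF assms(2)] by blast
  moreover have "{z \<in> S \<times> T. (case z of (x, y) \<Rightarrow> v x + w y) = n} \<subseteq> ?B"
  proof
    fix z assume "z \<in> {z \<in> S \<times> T. (case z of (x, y) \<Rightarrow> v x + w y) = n}"
    then obtain x y where z: "z = (x, y)" "x \<in> S" "y \<in> T" "v x + w y = n" by auto
    with gradedD(1)[OF assms(1) z(2)] gradedD(1)[OF assms(2) z(3)] show "z \<in> ?B" by auto
  qed
  ultimately show "finite {z \<in> S \<times> T. (case z of (x, y) \<Rightarrow> v x + w y) = n}"
    by (rule rev_finite_subset)
qed

lemma gf_times:
  assumes "graded S v" "graded T w"
  shows "gf S v * gf T w = gf (S \<times> T) (\<lambda>(x, y). v x + w y)"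
proof (rule fps_ext)
  fix n :: nat
  let ?P = "\<lambda>k. {x \<in> S. v x = int k} \<times> {y \<in> T. w y = int (n - k)}"
  have "{z \<in> S \<times> T. (case z of (x, y) \<Rightarrow> v x + w y) = int n} = (\<Union>k\<in>{0..n}. ?P k)" (is "?A = _")
  proof
    show "?A \<subseteq> (\<Union>k\<in>{0..n}. ?P k)"
    proof
      fix z assume "z \<in> ?A"
      then obtain x y where z: "z = (x, y)" and xy: "x \<in> S" "y \<in> T" "v x + w y = int n" by auto
      have "v x \<ge> 0" "w y \<ge> 0"
        using gradedD(1)[OF assms(1)] gradedD(1)[OF assms(2)] xy by blast+
      with xy z show "z \<in> (\<Union>k\<in>{0..n}. ?P k)"
        by (intro UN_I[of "nat (v x)"]) auto
    qed
  qed auto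
  also have "card \<dots> = (\<Sum>k\<in>{0..n}. card (?P k))"
    by (rule card_UN_disjoint) (use gradedD(2)[OF assms(1)] gradedD(2)[OF assms(2)] in auto)
  finally show "fps_nth (gf S v * gf T w) n = fps_nth (gf (S \<times> T) (\<lambda>(x, y). v x + w y)) n"
    by (simp add: gf_nth fps_mult_nth card_cartesian_product)
qed

lemma gf_bij:
  assumes "bij_betw f S T" "\<And>x. x \<in> S \<Longrightarrow> w (f x) = v x"
  shows "gf S v = gf T w"
proof (rule fps_ext)
  fix n
  have "bij_betw f {x \<in> S. v x = int n} {y \<in> T. w y = int n}"
    using assms by (auto simp: bij_betw_def inj_on_def image_iff)
  thus "fps_nth (gf S v) n = fps_nth (gf T w) n"
    by (simp add: gf_nth bij_betw_same_card)
qed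

lemma gf_union:
  assumes "graded S w" "graded T w" "S \<inter> T = {}"
  shows "gf (S \<union> T) w = gf S w + gf T w"
proof (rule fps_ext)
  fix n
  have "{x \<in> S \<union> T. w x = int n} = {x \<in> S. w x = int n} \<union> {x \<in> T. w x = int n}" by auto
  moreover have "card \<dots> = card {x \<in> S. w x = int n} + card {x \<in> T. w x = int n}"
    by (rule card_Un_disjoint) (use assms(3) gradedD(2)[OF assms(1)] gradedD(2)[OF assms(2)] in auto)
  ultimately show "fps_nth (gf (S \<union> T) w) n = fps_nth (gf S w + gf T w) n"
    by (simp only: gf_nth fps_add_nth of_nat_add)
qed

lemma gf_shift:
  assumes "graded S w"
  shows "fps_X ^ k * gf S w = gf S (\<lambda>x. w x + int k)"
proof (rule fps_ext)
  fix n
  have "{x \<in> S. w x + int k = int n} = (if n < k then {} else {x \<in> S. w x = int (n - k)})"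
    using gradedD(1)[OF assms] by (force simp: of_nat_diff)
  thus "fps_nth (fps_X ^ k * gf S w) n = fps_nth (gf S (\<lambda>x. w x + int k)) n"
    by (simp add: gf_nth fps_X_power_mult_nth)
qed

lemma even_card_involution:
  assumes "finite S" "\<And>x. x \<in> S \<Longrightarrow> f x \<in> S" "\<And>x. x \<in> S \<Longrightarrow> f (f x) = x"
    "\<And>x. x \<in> S \<Longrightarrow> f x \<noteq> x"
  shows "even (card S)"
  using assms
proof (induction "card S" arbitrary: S rule: less_induct)
  case less
  show ?case
  proof (cases "S = {}")
    case False
    then obtain x where x: "x \<in> S" by blast
    let ?S = "S - {x, f x}"
    have c: "card ?S = card S - 2"
      using x less.prems(2)[OF x] less.prems(4)[OF x]
      by (subst card_Diff_subset) (auto simp: card_insert_if)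
    have "card S \<ge> card {x, f x}"
      by (rule card_mono) (use x less.prems in auto)
    hence ge: "card S \<ge> 2" using less.prems(4)[OF x] by (simp add: card_insert_if split: if_splits)
    have "even (card ?S)"
    proof (rule less.hyps)
      show "f y \<in> ?S" if "y \<in> ?S" for y
        using less.prems(2,3) that x by (metis Diff_iff insert_iff singletonD)
    qed (use c ge less.prems in auto)
    thus ?thesis using c ge by simp
  qed simp
qed

text \<open>The involution splits each weight level of the symmetric difference into pairs. A pair
  may lie inside \<open>S - T\<close>, inside \<open>T - S\<close> or across both; in every case the
  two cardinalities keep the same parity.\<close>

lemma gf_eq_by_involution:
  assumes "graded S w" "graded T w"
    and "\<And>x. x \<in> S - T \<union> (T - S) \<Longrightarrow> f x \<in> S - T \<union> (T - S) \<and> f (f x) = x \<and> f x \<noteq> x \<and> w (f x) = w x"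
  shows "gf S w = gf T w"
proof (rule fps_ext)
  fix n
  let ?S = "{x \<in> S. w x = int n}" and ?T = "{x \<in> T. w x = int n}"
  have fin: "finite ?S" "finite ?T" by (rule gradedD(2)[OF assms(1)], rule gradedD(2)[OF assms(2)])
  have "even (card (?S - ?T \<union> (?T - ?S)))"
  proof (rule even_card_involution[where f = f])
    fix x assume "x \<in> ?S - ?T \<union> (?T - ?S)"
    hence x: "x \<in> S - T \<union> (T - S)" "w x = int n" by auto
    show "f x \<in> ?S - ?T \<union> (?T - ?S)" "f (f x) = x" "f x \<noteq> x"
      using assms(3)[OF x(1)] x(2) by auto
  qed (use fin in auto)
  moreover have "card (?S - ?T \<union> (?T - ?S)) = card (?S - ?T) + card (?T - ?S)"
    by (rule card_Un_disjoint) (use fin in auto)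
  moreover have "card ?S = card (?S - ?T) + card (?S \<inter> ?T)"
    "card ?T = card (?T - ?S) + card (?S \<inter> ?T)"
    using card_Int_Diff[OF fin(1), of ?T] card_Int_Diff[OF fin(2), of ?S] by (simp_all add: Int_commute)
  ultimately have "even (card ?S) = even (card ?T)" by auto
  thus "fps_nth (gf S w) n = fps_nth (gf T w) n"
    by (simp only: gf_nth of_nat_bit_eq_iff)
qed

section \<open>The Jacobi triple product modulo 2\<close>

lemma bit_fps_diff: "F - G = (F + G :: bit fps)"
  by (rule fps_ext) simp

lemma fps_mult_nth_cong:
  assumes "\<And>i. i \<le> n \<Longrightarrow> fps_nth F i = fps_nth F' i" "\<And>i. i \<le> n \<Longrightarrow> fps_nth G i = fps_nth G' i" "m \<le> n"
  shows "fps_nth (F * G) m = fps_nth (F' * G') m"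
  using assms by (simp add: fps_mult_nth)

text \<open>
  The product of all \<open>1 + X\<^bsup>Aj + r\<^esup>\<close>; for \<open>A, r > 0\<close> the factors with \<open>j \<ge> n\<close> do not affect the
  \<open>n\<close>-th coefficient.
\<close>

definition euler :: "nat \<Rightarrow> nat \<Rightarrow> bit fps" where
  "euler A r = Abs_fps (\<lambda>n. fps_nth (\<Prod>j<n. 1 + fps_X ^ (A * j + r)) n)"

lemma euler_nth:
  assumes "A > 0" "r > 0" "n \<le> N"
  shows "fps_nth (\<Prod>j<N. 1 + fps_X ^ (A * j + r)) n = fps_nth (euler A r) n"
  using assms(3)
proof (induction N rule: dec_induct)
  case base
  show ?case by (simp add: euler_def)
next
  case (step N)
  have "N * 1 \<le> A * N" using assms by (simp add: mult.commute)
  hence "n < A * N + r" using step assms by linarith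
  hence "fps_nth ((\<Prod>j<N. 1 + fps_X ^ (A * j + r)) * fps_X ^ (A * N + r)) n = (0 :: bit)"
    by (simp add: fps_X_power_mult_right_nth)
  thus ?case using step by (simp add: distrib_left)
qed

lemma euler_LIMSEQ:
  assumes "A > 0" "r > 0"
  shows "(\<lambda>N. \<Prod>j<N. 1 + fps_X ^ (A * j + r)) \<longlonglongrightarrow> euler A r"
  using euler_nth[OF assms] by (intro tendsto_fpsI) (auto simp: eventually_sequentially)

lemma euler_nth_0 [simp]: "fps_nth (euler A r) 0 = 1"
  by (simp add: euler_def)

lemma euler_nonzero [simp]: "euler A r \<noteq> 0"
  using euler_nth_0[of A r] by (metis fps_zero_nth zero_neq_one)

text \<open>The factors are sorted by the residue of \<open>j\<close> modulo \<open>k\<close>;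
  convergence is tested along the partial products with \<open>N * k\<close> factors.\<close>

lemma euler_split:
  assumes "A > 0" "r > 0" "k > 0"
  shows "euler A r = (\<Prod>s<k. euler (A * k) (A * s + r))"
proof (rule LIMSEQ_unique)
  have "strict_mono (\<lambda>N. N * k)"
    using assms by (simp add: strict_mono_def)
  from LIMSEQ_subseq_LIMSEQ[OF euler_LIMSEQ[OF assms(1,2)] this]
  show "(\<lambda>N. \<Prod>j<N * k. 1 + fps_X ^ (A * j + r)) \<longlonglongrightarrow> euler A r"
    by (simp add: o_def)
  have "(\<Prod>j<N * k. 1 + fps_X ^ (A * j + r)) = (\<Prod>s<k. \<Prod>j<N. 1 + fps_X ^ (A * k * j + (A * s + r)) :: bit fps)"
    for N :: nat
  proof -
    have "(\<Prod>j<N * k. 1 + fps_X ^ (A * j + r)) =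
        (\<Prod>j<N. \<Prod>i\<in>{j * k..<j * k + k}. 1 + fps_X ^ (A * i + r) :: bit fps)"
      by (rule prod.nat_group[symmetric])
    also have "\<dots> = (\<Prod>j<N. \<Prod>s<k. 1 + fps_X ^ (A * (j * k + s) + r))"
    proof (rule prod.cong[OF refl])
      fix j
      show "(\<Prod>i\<in>{j * k..<j * k + k}. 1 + fps_X ^ (A * i + r)) =
          (\<Prod>s<k. 1 + fps_X ^ (A * (j * k + s) + r) :: bit fps)"
        by (rule prod.reindex_bij_witness[of _ "\<lambda>s. j * k + s" "\<lambda>i. i - j * k"]) auto
    qed
    also have "\<dots> = (\<Prod>s<k. \<Prod>j<N. 1 + fps_X ^ (A * (j * k + s) + r))"
      by (rule prod.swap)
    finally show ?thesis by (simp add: algebra_simps)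
  qed
  thus "(\<lambda>N. \<Prod>j<N * k. 1 + fps_X ^ (A * j + r)) \<longlonglongrightarrow> (\<Prod>s<k. euler (A * k) (A * s + r))"
    using assms by (simp add: tendsto_prod_fps euler_LIMSEQ)
qed

text \<open>Frobenius: squaring a factor in characteristic 2 doubles its exponent.\<close>

lemma euler_square:
  assumes "A > 0" "r > 0"
  shows "euler (2 * A) (2 * r) = euler A r ^ 2"
proof (rule LIMSEQ_unique)
  show "(\<lambda>N. (\<Prod>j<N. 1 + fps_X ^ (A * j + r)) * (\<Prod>j<N. 1 + fps_X ^ (A * j + r))) \<longlonglongrightarrow> euler A r ^ 2"
    unfolding power2_eq_square by (intro tendsto_mult_fps euler_LIMSEQ assms)
  have sq: "(1 + fps_X ^ (A * j + r)) * (1 + fps_X ^ (A * j + r))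
      = (1 + fps_X ^ (2 * A * j + 2 * r) :: bit fps)" for j
  proof -
    have "2 * A * j + 2 * r = (A * j + r) * 2" by simp
    thus ?thesis
      using bit_fps_square_add[of 1 "fps_X ^ (A * j + r)"]
      by (simp only: power2_eq_square[symmetric] power_mult power_one)
  qed
  have "(\<Prod>j<N. 1 + fps_X ^ (A * j + r)) * (\<Prod>j<N. 1 + fps_X ^ (A * j + r))
      = (\<Prod>j<N. 1 + fps_X ^ (2 * A * j + 2 * r) :: bit fps)" for N
    by (simp only: prod.distrib[symmetric] sq)
  thus "(\<lambda>N. (\<Prod>j<N. 1 + fps_X ^ (A * j + r)) * (\<Prod>j<N. 1 + fps_X ^ (A * j + r)))
      \<longlonglongrightarrow> euler (2 * A) (2 * r)"
    using euler_LIMSEQ[of "2 * A" "2 * r"] assms by simp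
qed

section \<open>Gaussian binomials and the finite q-binomial theorem\<close>

fun gauss_binomial :: "'a :: comm_ring_1 \<Rightarrow> nat \<Rightarrow> nat \<Rightarrow> 'a" where
  "gauss_binomial q n 0 = 1"
| "gauss_binomial q 0 (Suc k) = 0"
| "gauss_binomial q (Suc n) (Suc k) = gauss_binomial q n (Suc k) + q ^ (n - k) * gauss_binomial q n k"

lemma gauss_binomial_eq_0: "n < k \<Longrightarrow> gauss_binomial q n k = 0"
  by (induction q n k rule: gauss_binomial.induct) auto

text \<open>This is the quotient formula for Gaussian binomials cleared of denominators, so that it
  holds in every commutative ring. It follows from the Pascal recursion.\<close>

lemma gauss_binomial_mult:
  assumes "k \<le> n"
  shows "gauss_binomial q n k * (\<Prod>i<k. 1 - q ^ Suc i) * (\<Prod>i<n - k. 1 - q ^ Suc i)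
    = (\<Prod>i<n. 1 - q ^ Suc i)"
  using assms
proof (induction q n k rule: gauss_binomial.induct)
  case (3 q n k)
  let ?c = "\<lambda>n. \<Prod>i<n. 1 - q ^ Suc i" and ?g = "gauss_binomial q n"
  have k: "k \<le> n" using 3 by simp
  \<comment> \<open>For \<open>k = n\<close> both sides vanish, the right one because of the factor
    \<open>1 - q ^ 0\<close>.\<close>
  have 1: "?g (Suc k) * ?c (Suc k) * ?c (n - k) = ?c n * (1 - q ^ (n - k))"
  proof (cases "k = n")
    case False
    hence "n - k = Suc (n - Suc k)" using k by simp
    hence c: "?c (n - k) = ?c (n - Suc k) * (1 - q ^ (n - k))" by (simp only: prod.lessThan_Suc)
    have g: "?g (Suc k) * ?c (Suc k) * ?c (n - Suc k) = ?c n"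
      by (rule 3(1)) (use k False in simp)
    show ?thesis by (simp only: c g[symmetric] mult.assoc)
  qed (simp add: gauss_binomial_eq_0)
  have 2: "?g k * ?c k * ?c (n - k) = ?c n" using 3(2) k by simp
  have "gauss_binomial q (Suc n) (Suc k) * ?c (Suc k) * ?c (n - k)
     = ?g (Suc k) * ?c (Suc k) * ?c (n - k) + q ^ (n - k) * (?g k * ?c k * ?c (n - k)) * (1 - q ^ Suc k)"
    by (simp add: algebra_simps)
  also have "\<dots> = ?c n * (1 - q ^ (n - k) + q ^ (n - k) * (1 - q ^ Suc k))"
    unfolding 1 2 by (simp only: ring_distribs mult.assoc mult.left_commute mult.commute)
  also have "1 - q ^ (n - k) + q ^ (n - k) * (1 - q ^ Suc k) = 1 - q ^ (n - k + Suc k)"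
    unfolding power_add by (simp add: algebra_simps)
  also have "n - k + Suc k = Suc n" using k by simp
  finally show ?case by simp
qed auto

text \<open>The form homogeneous in \<open>u\<close> and \<open>v\<close> permits
  \<open>u = fps_X ^ (A * n)\<close> below, which avoids negative powers of the variable.\<close>

lemma q_binomial_theorem:
  fixes u v q :: "'a :: comm_ring_1"
  shows "(\<Prod>i<n. u + v * q ^ i) = (\<Sum>k\<le>n. gauss_binomial q n k * q ^ (k choose 2) * v ^ k * u ^ (n - k))"
proof (induction n)
  case (Suc n)
  let ?g = "gauss_binomial q"
  let ?t = "\<lambda>k. ?g n k * q ^ (k choose 2) * v ^ k * u ^ (n - k)"
  have "(\<Sum>k\<le>Suc n. ?g (Suc n) k * q ^ (k choose 2) * v ^ k * u ^ (Suc n - k))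
    = u ^ Suc n + (\<Sum>k\<le>n. ?g (Suc n) (Suc k) * q ^ (Suc k choose 2) * v ^ Suc k * u ^ (n - k))"
    by (subst sum.atMost_Suc_shift) (simp add: binomial_eq_0)
  also have "(\<Sum>k\<le>n. ?g (Suc n) (Suc k) * q ^ (Suc k choose 2) * v ^ Suc k * u ^ (n - k))
    = (\<Sum>k\<le>n. ?g n (Suc k) * q ^ (Suc k choose 2) * v ^ Suc k * u ^ (n - k)) + (\<Sum>k\<le>n. ?t k * (v * q ^ n))"
  proof -
    have "?g (Suc n) (Suc k) * q ^ (Suc k choose 2) * v ^ Suc k * u ^ (n - k) =
      ?g n (Suc k) * q ^ (Suc k choose 2) * v ^ Suc k * u ^ (n - k) + ?t k * (v * q ^ n)" if "k \<le> n" for k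
    proof -
      have "Suc k choose 2 = (k choose 2) + k" by (simp add: numeral_2_eq_2)
      moreover have "q ^ n = q ^ (n - k) * q ^ k" using that by (simp flip: power_add)
      ultimately show ?thesis by (simp add: algebra_simps power_add)
    qed
    thus ?thesis by (simp flip: sum.distrib)
  qed
  also have "u ^ Suc n + ((\<Sum>k\<le>n. ?g n (Suc k) * q ^ (Suc k choose 2) * v ^ Suc k * u ^ (n - k))
      + (\<Sum>k\<le>n. ?t k * (v * q ^ n))) =
    (\<Sum>k\<le>Suc n. ?g n k * q ^ (k choose 2) * v ^ k * u ^ (Suc n - k)) + (\<Sum>k\<le>n. ?t k * (v * q ^ n))"
    by (subst sum.atMost_Suc_shift) (simp add: binomial_eq_0)
  also have "(\<Sum>k\<le>Suc n. ?g n k * q ^ (k choose 2) * v ^ k * u ^ (Suc n - k)) = (\<Sum>k\<le>n. ?t k * u)"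
    by (simp add: gauss_binomial_eq_0 Suc_diff_le mult_ac)
  finally show ?case
    by (simp add: Suc.IH distrib_left sum_distrib_right)
qed (simp add: binomial_eq_0)


section \<open>Theta series and the passage from the finite to the infinite triple product\<close>

definition tri :: "int \<Rightarrow> int" where
  "tri n = n * (n - 1) div 2"

lemma tri: "2 * tri n = n * (n - 1)"
proof -
  have "even (n * (n - 1))" by simp
  thus ?thesis unfolding tri_def by simp
qed

lemma tri_eqI: "2 * m = n * (n - 1) \<Longrightarrow> tri n = m"
  using tri[of n] by linarith

lemma tri_choose: "tri (int n) = int (n choose 2)"
proof (rule tri_eqI)
  have "even (n * (n - 1))" by auto
  hence "2 * (n choose 2) = n * (n - 1)" unfolding choose_two by (rule dvd_mult_div_cancel)
  thus "2 * int (n choose 2) = int n * (int n - 1)"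
    by (cases n) (auto simp flip: of_nat_mult simp: algebra_simps)
qed

text \<open>This is Ramanujan's f(a, b) with a = q^r and b = q^(A - r), reduced modulo 2.\<close>

definition theta :: "nat \<Rightarrow> nat \<Rightarrow> bit fps" where
  "theta A r = gf UNIV (\<lambda>n. int A * tri n + int r * n)"

text \<open>The linear bound makes each weight level finite, and it also confines weight
  \<open>n\<close> to the range of summation of the finite triple product.\<close>

lemma theta_weight_ge:
  assumes "0 < r" "r < A"
  shows "\<bar>n\<bar> \<le> int A * tri n + int r * n"
proof (cases "n > 0")
  case True
  have "tri n \<ge> 0" using tri[of n] True by (metis mult_nonneg_nonneg zero_le_mult_iff int_one_le_iff_zero_less diff_ge_0_iff_ge zero_less_numeral less_le_not_le not_less)
  hence "int A * tri n \<ge> 0" by simp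
  moreover have "int r * n \<ge> 1 * n" using assms True by (intro mult_right_mono) auto
  ultimately show ?thesis using True by linarith
next
  case False
  define m where "m = - n"
  have m: "m \<ge> 0" and n: "n = - m" using False by (auto simp: m_def)
  have t: "2 * tri n = m * (m + 1)" unfolding tri n by (simp add: algebra_simps)
  have "tri n \<ge> m"
  proof (cases "m = 0")
    case False
    hence "m * (m + 1) \<ge> m * 2" using m by (intro mult_left_mono) auto
    thus ?thesis using t by linarith
  qed (use t in simp)
  hence "int A * tri n \<ge> int A * m" by (intro mult_left_mono) auto
  moreover have "int A * m \<ge> (int r + 1) * m" using assms m by (intro mult_right_mono) auto
  ultimately show ?thesis using m n by (simp add: algebra_simps)
qed

lemma graded_theta:
  assumes "0 < r" "r < A"
  shows "graded UNIV (\<lambda>n. int A * tri n + int r * n)"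
proof (rule gradedI)
  fix n
  show "int A * tri n + int r * n \<ge> 0" using theta_weight_ge[OF assms, of n] by linarith
  have "{x \<in> UNIV. int A * tri x + int r * x = n} \<subseteq> {-n..n}"
  proof
    fix x assume "x \<in> {x \<in> UNIV. int A * tri x + int r * x = n}"
    thus "x \<in> {-n..n}" using theta_weight_ge[OF assms, of x] by auto
  qed
  thus "finite {x \<in> UNIV. int A * tri x + int r * x = n}" by (rule finite_subset) simp
qed


lemma prod_lessThan_add:
  "(\<Prod>i<m + n. f i) = (\<Prod>i<m. f i) * (\<Prod>i<n. f (m + i))" for f :: "nat \<Rightarrow> 'a :: comm_monoid_mult"
  by (induction n) (simp_all add: mult.assoc)

text \<open>The q-binomial theorem is applied to \<open>2 * n\<close> factors. The upper half of
  them yields the first product and the lower half, in reversed order, the second one, each times a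
  monomial. Recentring the sum at \<open>n\<close> lets the same monomial \<open>fps_X ^ s\<close>
  be cancelled from both sides.\<close>

lemma finite_Jacobi:
  assumes "0 < r" "r < A"
  shows "(\<Prod>j<n. 1 + fps_X ^ (A * j + r)) * (\<Prod>j<n. 1 + fps_X ^ (A * j + (A - r)))
    = (\<Sum>j\<le>2 * n. gauss_binomial (fps_X ^ A) (2 * n) j
        * fps_X ^ nat (int A * tri (int j - int n) + int r * (int j - int n)) :: bit fps)"
proof -
  let ?X = "fps_X :: bit fps"
  define P1 where "P1 = (\<Prod>j<n. 1 + ?X ^ (A * j + r))"
  define P2 where "P2 = (\<Prod>j<n. 1 + ?X ^ (A * j + (A - r)))"
  define s where "s = (\<Sum>i<n. A * i + r) + A * n * n"
  define w where "w = (\<lambda>k. int A * tri k + int r * k)"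
  have w: "w k \<ge> 0" for k using theta_weight_ge[OF assms, of k] by (simp add: w_def)
  have "(\<Prod>i<2 * n. ?X ^ (A * n) + ?X ^ r * (?X ^ A) ^ i)
      = (\<Prod>i<n. ?X ^ (A * n) + ?X ^ r * (?X ^ A) ^ i) * (\<Prod>i<n. ?X ^ (A * n) + ?X ^ r * (?X ^ A) ^ (n + i))"
    unfolding mult_2 by (rule prod_lessThan_add)
  also have "(\<Prod>i<n. ?X ^ (A * n) + ?X ^ r * (?X ^ A) ^ (n + i)) = ?X ^ (A * n * n) * P1"
  proof -
    have *: "?X ^ (A * n) + ?X ^ r * (?X ^ A) ^ (n + i) = ?X ^ (A * n) * (1 + ?X ^ (A * i + r))" for i
      by (simp only: distrib_left mult_1_right power_add[symmetric] power_mult[symmetric])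
        (simp add: algebra_simps)
    show ?thesis
      by (simp only: * P1_def prod.distrib prod_constant card_lessThan power_mult[of _ "A * n" n])
  qed
  also have "(\<Prod>i<n. ?X ^ (A * n) + ?X ^ r * (?X ^ A) ^ i) = ?X ^ (\<Sum>i<n. A * i + r) * P2"
  proof -
    have P2: "P2 = (\<Prod>i<n. 1 + ?X ^ (A * (n - Suc i) + (A - r)))"
      unfolding P2_def by (rule prod.nat_diff_reindex[symmetric])
    have *: "?X ^ (A * n) + ?X ^ r * (?X ^ A) ^ i
        = ?X ^ (A * i + r) * (1 + ?X ^ (A * (n - Suc i) + (A - r)))" if "i < n" for i
    proof -
      have "A * i + r + (A * (n - Suc i) + (A - r)) = A * (i + (n - Suc i) + 1)"
        using assms unfolding distrib_left by linarith
      also have "i + (n - Suc i) + 1 = n" using that by linarith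
      finally show ?thesis
        by (simp only: distrib_left mult_1_right power_add[symmetric] power_mult[symmetric])
          (simp add: add.commute)
    qed
    have "(\<Prod>i<n. ?X ^ (A * n) + ?X ^ r * (?X ^ A) ^ i)
        = (\<Prod>i<n. ?X ^ (A * i + r) * (1 + ?X ^ (A * (n - Suc i) + (A - r))))"
      by (rule prod.cong[OF refl]) (simp only: * lessThan_iff)
    thus ?thesis by (simp only: prod.distrib power_sum P2)
  qed
  finally have L: "(\<Prod>i<2 * n. ?X ^ (A * n) + ?X ^ r * (?X ^ A) ^ i) = ?X ^ s * (P1 * P2)"
    by (simp add: s_def power_add mult_ac)
  have "(\<Prod>i<2 * n. ?X ^ (A * n) + ?X ^ r * (?X ^ A) ^ i)
    = (\<Sum>j\<le>2 * n. gauss_binomial (?X ^ A) (2 * n) j * (?X ^ A) ^ (j choose 2) * (?X ^ r) ^ j * (?X ^ (A * n)) ^ (2 * n - j))"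
    by (rule q_binomial_theorem)
  also have "\<dots> = (\<Sum>j\<le>2 * n. ?X ^ s * (gauss_binomial (?X ^ A) (2 * n) j * ?X ^ nat (w (int j - int n))))"
  proof (rule sum.cong[OF refl])
    fix j assume "j \<in> {..2 * n}"
    hence j: "j \<le> 2 * n" by simp
    have "A * (j choose 2) + r * j + A * n * (2 * n - j) = s + nat (w (int j - int n))" (is "?L = _")
    proof -
      define L where "L = ?L"
      \<comment> \<open>The exponents are compared after doubling, which removes the halves in
        \<open>tri\<close>, in the binomial coefficient and in \<open>s\<close>.\<close>
      have "2 * (\<Sum>i<n. A * i + r) + A * n = A * n * n + 2 * r * n"
        by (induction n) (simp_all add: algebra_simps)
      hence "int (2 * s + A * n) = int (A * n * n + 2 * r * n + 2 * (A * n * n))"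
        unfolding s_def by (intro arg_cong[of _ _ int]) (simp add: distrib_left)
      hence s: "2 * int s = int A * int n * int n + 2 * int r * int n - int A * int n + 2 * (int A * int n * int n)"
        by (simp only: of_nat_add of_nat_mult of_nat_numeral)
      have j': "int (2 * n - j) = 2 * int n - int j" using j by simp
      have "2 * w (int j - int n) = int A * ((int j - int n) * (int j - int n - 1)) + 2 * int r * (int j - int n)"
        unfolding tri[symmetric] w_def by (simp add: algebra_simps)
      moreover have "2 * int (j choose 2) = int j * (int j - 1)"
        using tri[of "int j"] tri_choose[of j] by simp
      hence "2 * int (A * (j choose 2)) = int A * (int j * (int j - 1))"
        by simp
      ultimately have "2 * int L = 2 * (int s + w (int j - int n))"
        using s unfolding L_def of_nat_add of_nat_mult j' by (simp add: algebra_simps)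
      thus ?thesis using w[of "int j - int n"] unfolding L_def[symmetric] by arith
    qed
    thus "gauss_binomial (?X ^ A) (2 * n) j * (?X ^ A) ^ (j choose 2) * (?X ^ r) ^ j * (?X ^ (A * n)) ^ (2 * n - j)
      = ?X ^ s * (gauss_binomial (?X ^ A) (2 * n) j * ?X ^ nat (w (int j - int n)))"
      by (simp only: mult.assoc mult.left_commute[of "?X ^ s"] power_mult[symmetric] power_add[symmetric] add.assoc)
  qed
  finally have "?X ^ s * (P1 * P2)
      = ?X ^ s * (\<Sum>j\<le>2 * n. gauss_binomial (?X ^ A) (2 * n) j * ?X ^ nat (w (int j - int n)))"
    unfolding L by (simp only: sum_distrib_left)
  thus ?thesis by (simp add: P1_def P2_def w_def)
qed

text \<open>As \<open>k\<close> and \<open>n - k\<close> grow, the Gaussian binomial tends to the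
  inverse of the infinite product. In \<open>gauss_binomial_mult\<close> all three partial products
  agree with \<open>euler A A\<close> up to degree \<open>i\<close>; one of the two copies on the
  left is then cancelled against the right side.\<close>

lemma gauss_binomial_limit:
  assumes "A > 0" "k \<le> n" "i \<le> k" "i + k \<le> n"
  shows "fps_nth (gauss_binomial (fps_X ^ A) n k * euler A A) i = fps_nth (1 :: bit fps) i"
proof -
  define g where "g = gauss_binomial (fps_X ^ A :: bit fps) n k"
  let ?E = "euler A A" and ?c = "\<lambda>n. \<Prod>i<n. 1 - (fps_X ^ A) ^ Suc i :: bit fps"
  have c: "?c m = (\<Prod>j<m. 1 + fps_X ^ (A * j + A))" for m
    by (simp only: bit_fps_diff power_mult[symmetric] mult_Suc_right add.commute[of A])
  have c_nth: "fps_nth (?c m) l = fps_nth ?E l" if "l \<le> m" for m l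
    unfolding c by (rule euler_nth) (use assms that in auto)
  have E: "?E * inverse ?E = 1" using inverse_mult_eq_1[of ?E] by (simp add: mult.commute)
  have "fps_nth (g * ?E * ?E) l = fps_nth ?E l" if "l \<le> i" for l
  proof -
    have "fps_nth (g * ?E * ?E) l = fps_nth (g * ?c k * ?c (n - k)) l"
    proof (rule fps_mult_nth_cong[where n = l])
      show "fps_nth (g * ?E) m = fps_nth (g * ?c k) m" if "m \<le> l" for m
        by (rule fps_mult_nth_cong[where n = m]) (use \<open>l \<le> i\<close> that assms in \<open>auto simp only: c_nth\<close>)
      show "fps_nth ?E m = fps_nth (?c (n - k)) m" if "m \<le> l" for m
        by (rule c_nth[symmetric]) (use \<open>l \<le> i\<close> that assms in linarith)
    qed simp
    also have "\<dots> = fps_nth (?c n) l" unfolding g_def by (simp only: gauss_binomial_mult[OF assms(2)])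
    also have "\<dots> = fps_nth ?E l" by (rule c_nth) (use that assms in linarith)
    finally show ?thesis .
  qed
  hence "fps_nth (g * ?E * ?E * inverse ?E) i = fps_nth (?E * inverse ?E) i"
    by (intro fps_mult_nth_cong[where n = i]) auto
  thus ?thesis by (simp only: g_def mult.assoc E mult_1_right)
qed

theorem Jacobi_triple_product:
  assumes "0 < r" "r < A"
  shows "theta A r = euler A r * euler A (A - r) * euler A A"
proof (rule fps_ext)
  fix n
  define w where "w = (\<lambda>k. int A * tri k + int r * k)"
  have w: "\<bar>k\<bar> \<le> w k" for k using theta_weight_ge[OF assms, of k] by (simp add: w_def)
  let ?g = "gauss_binomial (fps_X ^ A :: bit fps) (2 * n)"
  have "fps_nth (euler A r * euler A (A - r) * euler A A) n =
    fps_nth ((\<Prod>j<n. 1 + fps_X ^ (A * j + r)) * (\<Prod>j<n. 1 + fps_X ^ (A * j + (A - r))) * euler A A) n"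
  proof (rule fps_mult_nth_cong[where n = n])
    show "fps_nth (euler A r * euler A (A - r)) m = fps_nth
      ((\<Prod>j<n. 1 + fps_X ^ (A * j + r)) * (\<Prod>j<n. 1 + fps_X ^ (A * j + (A - r)))) m" if "m \<le> n" for m
      by (rule fps_mult_nth_cong[where n = m]; (rule euler_nth[symmetric])?) (use assms that in auto)
  qed simp_all
  also have "\<dots> = fps_nth (\<Sum>j\<le>2 * n. fps_X ^ nat (w (int j - int n)) * (?g j * euler A A)) n"
    unfolding finite_Jacobi[OF assms] w_def sum_distrib_right by (simp only: mult_ac)
  also have "\<dots> = (\<Sum>j\<le>2 * n. if w (int j - int n) = int n then 1 else 0)"
    unfolding fps_sum_nth
  proof (rule sum.cong[OF refl])
    fix j assume "j \<in> {..2 * n}"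
    hence j: "j \<le> 2 * n" by simp
    let ?k = "int j - int n"
    show "fps_nth (fps_X ^ nat (w ?k) * (?g j * euler A A)) n = (if w ?k = int n then 1 else 0)"
    proof (cases "w ?k \<le> int n")
      case True
      \<comment> \<open>The bound \<open>\<bar>k\<bar> \<le> w k\<close> is what brings the degree
        \<open>n - w k\<close> into the range of \<open>gauss_binomial_limit\<close>.\<close>
      have "fps_nth (?g j * euler A A) (n - nat (w ?k)) = fps_nth 1 (n - nat (w ?k))"
        by (rule gauss_binomial_limit) (use assms j w[of ?k] True in linarith)+
      thus ?thesis using True w[of ?k] by (auto simp: fps_X_power_mult_nth)
    qed (auto simp: fps_X_power_mult_nth)
  qed
  also have "\<dots> = of_nat (card {j \<in> {..2 * n}. w (int j - int n) = int n})"
    by (simp add: sum.If_cases Int_def)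
  also have "card {j \<in> {..2 * n}. w (int j - int n) = int n} = card {k \<in> UNIV. w k = int n}"
  proof (rule bij_betw_same_card[OF bij_betw_byWitness[where f = "\<lambda>j. int j - int n" and f' = "\<lambda>k. nat (k + int n)"]])
    show "\<forall>k\<in>{k \<in> UNIV. w k = int n}. int (nat (k + int n)) - int n = k"
    proof
      fix k assume "k \<in> {k \<in> UNIV. w k = int n}"
      thus "int (nat (k + int n)) - int n = k" using w[of k] by simp
    qed
    show "(\<lambda>k. nat (k + int n)) ` {k \<in> UNIV. w k = int n} \<subseteq> {j \<in> {..2 * n}. w (int j - int n) = int n}"
    proof (rule image_subsetI)
      fix k assume "k \<in> {k \<in> UNIV. w k = int n}"
      thus "nat (k + int n) \<in> {j \<in> {..2 * n}. w (int j - int n) = int n}"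
        using w[of k] by auto
    qed
  qed auto
  finally show "fps_nth (theta A r) n = fps_nth (euler A r * euler A (A - r) * euler A A) n"
    by (simp only: theta_def gf_nth w_def)
qed

section \<open>Kronecker's double series\<close>

lemma graded_bij:
  assumes "graded S v" "bij_betw f S T" "\<And>x. x \<in> S \<Longrightarrow> w (f x) = v x"
  shows "graded T w"
proof (rule gradedI)
  have T: "T = f ` S" using assms(2) by (simp add: bij_betw_def)
  show "w y \<ge> 0" if "y \<in> T" for y
    using that assms(3) gradedD(1)[OF assms(1)] by (auto simp: T)
  fix n
  have "{y \<in> T. w y = n} = f ` {x \<in> S. v x = n}"
    using assms(3) by (auto simp: T)
  thus "finite {y \<in> T. w y = n}" using gradedD(2)[OF assms(1)] by simp
qed

lemma tri_ge: "tri n \<ge> 0" "tri n \<ge> n - 1" "tri n \<ge> - n"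
proof -
  show 0: "tri n \<ge> 0"
  proof (cases "n \<ge> 1")
    case True
    hence "n * (n - 1) \<ge> 0" by simp
    thus ?thesis using tri[of n] by linarith
  next
    case False
    hence "(- n) * (1 - n) \<ge> 0" by (intro mult_nonneg_nonneg) auto
    thus ?thesis using tri[of n] by (simp add: algebra_simps)
  qed
  have "(n - 1) * (n - 2) \<ge> 0"
  proof (cases "n \<ge> 2")
    case False
    hence "(1 - n) * (2 - n) \<ge> 0" by (intro mult_nonneg_nonneg) auto
    thus ?thesis by (simp add: algebra_simps)
  qed simp
  thus "tri n \<ge> n - 1" using tri[of n] by (simp add: algebra_simps)
  have "n * (n + 1) \<ge> 0"
  proof (cases "n \<ge> 0")
    case False
    hence "(- n) * (- n - 1) \<ge> 0" by (intro mult_nonneg_nonneg) auto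
    thus ?thesis by (simp add: algebra_simps)
  qed simp
  thus "tri n \<ge> - n" using tri[of n] by (simp add: algebra_simps)
qed

lemma tri_add: "tri (m + n) = tri m + tri n + m * n"
  by (rule tri_eqI) (use tri[of m] tri[of n] in \<open>simp add: algebra_simps\<close>)

lemma tri_minus: "tri (- n) = tri n + n"
  by (rule tri_eqI) (use tri[of n] in \<open>simp add: algebra_simps\<close>)

lemma tri_1 [simp]: "tri 1 = 0"
  by (simp add: tri_def)

text \<open>Zero counts as nonnegative, so the second quadrant is \<open>i, j \<le> -1\<close>.
  Kronecker's series carries a minus sign there, which disappears modulo 2.\<close>

definition same_sign :: "(int \<times> int) set" where
  "same_sign = {(i, j). (0 \<le> i) = (0 \<le> j)}"

definition kronecker :: "nat \<Rightarrow> nat \<Rightarrow> nat \<Rightarrow> bit fps" where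
  "kronecker A r s = gf same_sign (\<lambda>(i, j). int A * (i * j) + int r * i + int s * j)"

text \<open>Summing over \<open>i\<close> first gives geometric series: this is the sum over all
  \<open>j\<close> of Q^(j(j+1)/2) / (1 - q^r Q^j) with Q = q^A, the partial fraction expansion of
  (Q)^3 divided by the theta function of q^r.\<close>

definition kron_aux :: "nat \<Rightarrow> nat \<Rightarrow> bit fps" where
  "kron_aux A r = gf same_sign (\<lambda>(i, j). int A * (i * j + tri (j + 1)) + int r * i)"

lemma graded_same_signI:
  assumes "\<And>i j. i \<ge> 0 \<Longrightarrow> j \<ge> 0 \<Longrightarrow> i + j \<le> w (i, j)"
    and "\<And>a b. a \<ge> 0 \<Longrightarrow> b \<ge> 0 \<Longrightarrow> a + b \<le> w (- 1 - a, - 1 - b)"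
  shows "graded same_sign w"
proof (rule gradedI)
  have *: "0 \<le> w x \<and> x \<in> {- 1 - w x..w x} \<times> {- 1 - w x..w x}" if "x \<in> same_sign" for x
  proof -
    obtain i j where x: "x = (i, j)" by (cases x)
    show ?thesis
    proof (cases "i \<ge> 0")
      case True
      thus ?thesis using that assms(1)[of i j] by (auto simp: x same_sign_def)
    next
      case False
      thus ?thesis using that assms(2)[of "- 1 - i" "- 1 - j"] by (auto simp: x same_sign_def)
    qed
  qed
  show "w x \<ge> 0" if "x \<in> same_sign" for x using *[OF that] by simp
  fix n
  have "{x \<in> same_sign. w x = n} \<subseteq> {- 1 - n..n} \<times> {- 1 - n..n}" using * by blast
  thus "finite {x \<in> same_sign. w x = n}" by (rule finite_subset) simp
qed

lemma graded_kronecker: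
  assumes "0 < r" "0 < s" "r + s \<le> A"
  shows "graded same_sign (\<lambda>(i, j). int A * (i * j) + int r * i + int s * j)"
proof (rule graded_same_signI; clarsimp)
  fix i j :: int assume ij: "i \<ge> 0" "j \<ge> 0"
  have "1 * i \<le> int r * i" "1 * j \<le> int s * j" "int A * (i * j) \<ge> 0"
    using assms ij by (intro mult_right_mono mult_nonneg_nonneg; simp)+
  thus "i + j \<le> int A * (i * j) + int r * i + int s * j" by linarith
next
  fix a b :: int assume ab: "a \<ge> 0" "b \<ge> 0"
  have "1 * a \<le> (int A - int r) * a" "1 * b \<le> (int A - int s) * b" "int A * (a * b) \<ge> 0"
    using assms ab by (intro mult_right_mono mult_nonneg_nonneg; simp)+
  moreover have "int r + int s \<le> int A" using assms by simp
  ultimately show "a + b \<le> int A * ((- 1 - a) * (- 1 - b)) + int r * (- 1 - a) + int s * (- 1 - b)"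
    by (simp add: algebra_simps)
qed

lemma graded_kron_aux:
  assumes "0 < r" "r < A"
  shows "graded same_sign (\<lambda>(i, j). int A * (i * j + tri (j + 1)) + int r * i)"
proof (rule graded_same_signI; clarsimp)
  fix i j :: int assume ij: "i \<ge> 0" "j \<ge> 0"
  have "1 * i \<le> int r * i" "1 * tri (j + 1) \<le> int A * tri (j + 1)" "int A * (i * j) \<ge> 0"
    using assms ij tri_ge(1) by (intro mult_right_mono mult_nonneg_nonneg; simp)+
  thus "i + j \<le> int A * (i * j + tri (j + 1)) + int r * i"
    using tri_ge(2)[of "j + 1"] by (simp add: distrib_left)
next
  fix a b :: int assume ab: "a \<ge> 0" "b \<ge> 0"
  have "1 * (a + 1) \<le> (int A - int r) * (a + 1)" "1 * tri (- b) \<le> int A * tri (- b)"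
    "int A * (a * b) \<ge> 0" "1 * b \<le> int A * b"
    using assms ab tri_ge(1) by (intro mult_right_mono mult_nonneg_nonneg; simp)+
  thus "a + b \<le> int A * ((- 1 - a) * (- 1 - b) + tri (- b)) + int r * (- 1 - a)"
    using tri_ge(1)[of "- b"] by (simp add: algebra_simps)
qed

lemma kronecker_commute: "kronecker A r s = kronecker A s r"
  unfolding kronecker_def
  by (rule gf_bij[where f = prod.swap]) (auto simp: same_sign_def bij_betw_def inj_on_def image_iff)

text \<open>
  Shifting \<open>i\<close> by \<open>m = j + n\<close> turns the left product into a sum over the same weights as the right one,
  but over other index sets. The two sets differ in whole rows \<open>(i, m)\<close> with \<open>j\<close> arbitrary, where the
  reflection of \<open>j\<close> in \<open>- i - 1 / 2\<close> preserves the weight, so that they cancel modulo 2.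
\<close>

lemma kronecker_theta:
  assumes "0 < r" "0 < s" "r + s < A"
  shows "kronecker A r s * theta A s = kron_aux A r * theta A (r + s)"
proof -
  let ?k = "\<lambda>(i, j). int A * (i * j) + int r * i + int s * j"
  let ?h = "\<lambda>(i, j). int A * (i * j + tri (j + 1)) + int r * i"
  let ?t = "\<lambda>r n. int A * tri n + int r * n"
  let ?W = "\<lambda>(x, m). ?h x + ?t (r + s) m"
  define L :: "((int \<times> int) \<times> int) set" where "L = {((i, j), m). (0 \<le> i + m) = (0 \<le> j)}"
  let ?f = "\<lambda>((i, j), n). ((i - (j + n), j), j + n) :: (int \<times> int) \<times> int"
  let ?g = "\<lambda>((i, j), m). ((i, - 1 - 2 * i - j), m) :: (int \<times> int) \<times> int"
  have gk: "graded same_sign ?k" by (rule graded_kronecker) (use assms in auto)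
  have gs: "graded UNIV (?t s)" by (rule graded_theta) (use assms in auto)
  have grs: "graded UNIV (?t (r + s))" by (rule graded_theta) (use assms in auto)
  have gh: "graded same_sign ?h" by (rule graded_kron_aux) (use assms in auto)
  have bij: "bij_betw ?f (same_sign \<times> UNIV) L"
    by (rule bij_betw_byWitness[where f' = "\<lambda>((i, j), m). ((i + m, j), m - j)"])
      (auto simp: L_def same_sign_def)
  have W: "?W (?f x) = (case x of (x, y) \<Rightarrow> ?k x + ?t s y)" for x
  proof -
    obtain i j n where x: "x = ((i, j), n)" by (metis prod.exhaust)
    have "tri (j + n) = tri j + tri n + j * n" "tri (j + 1) = tri j + j"
      by (simp_all add: tri_add)
    moreover have "int A * (2 * tri j) = int A * (j * j - j)"
      by (simp only: tri) (simp add: algebra_simps)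
    ultimately show ?thesis unfolding x by (simp add: algebra_simps)
  qed
  have gL: "graded L ?W"
    by (rule graded_bij[OF graded_Times[OF gk gs] bij]) (rule W)
  have "kronecker A r s * theta A s = gf (same_sign \<times> UNIV) (\<lambda>(x, y). ?k x + ?t s y)"
    unfolding kronecker_def theta_def by (rule gf_times[OF gk gs])
  also have "\<dots> = gf L ?W"
    by (rule gf_bij[OF bij]) (rule W)
  also have "\<dots> = gf (same_sign \<times> UNIV) ?W"
  proof (rule gf_eq_by_involution[OF gL graded_Times[OF gh grs], where f = ?g])
    fix x :: "(int \<times> int) \<times> int"
    obtain i j m where x: "x = ((i, j), m)" by (metis prod.exhaust)
    assume "x \<in> L - same_sign \<times> UNIV \<union> (same_sign \<times> UNIV - L)"
    hence sign: "(0 \<le> i + m) \<noteq> (0 \<le> i)" by (auto simp: x L_def same_sign_def)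
    define j' where "j' = - 1 - 2 * i - j"
    have gx: "?g x = ((i, j'), m)" "?g ((i, j'), m) = x" by (simp_all add: x j'_def)
    \<comment> \<open>The sum \<open>j + j'\<close> is the odd number
      \<open>- 1 - 2 * i\<close>.\<close>
    have ne: "j' \<noteq> j" unfolding j'_def by presburger
    have "i * j' + tri (j' + 1) = i * j + tri (j + 1)"
      using tri[of "j' + 1"] tri[of "j + 1"] by (simp add: j'_def algebra_simps)
    hence w: "?W ((i, j'), m) = ?W x" by (simp add: x)
    have "((i, j'), m) \<in> L - same_sign \<times> UNIV \<union> (same_sign \<times> UNIV - L)"
      using sign by (auto simp: L_def same_sign_def)
    thus "?g x \<in> L - same_sign \<times> UNIV \<union> (same_sign \<times> UNIV - L) \<and> ?g (?g x) = x \<and> ?g x \<noteq> x \<and> ?W (?g x) = ?W x"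
      unfolding gx using w ne by (simp add: x)
  qed
  also have "\<dots> = kron_aux A r * theta A (r + s)"
    unfolding kron_aux_def theta_def by (rule gf_times[OF gh grs, symmetric])
  finally show ?thesis .
qed

lemma theta_nonzero [simp]:
  assumes "0 < r" "r < A"
  shows "theta A r \<noteq> 0"
  using Jacobi_triple_product[OF assms] by simp

lemma theta_reflect:
  assumes "r \<le> A"
  shows "theta A (A - r) = theta A r"
  unfolding theta_def
  by (rule gf_bij[where f = uminus])
    (use assms in \<open>auto simp: bij_betw_def inj_on_def tri_minus of_nat_diff algebra_simps intro: image_eqI[of _ _ "- x" for x]\<close>)

lemma kronecker_mult_theta:
  assumes "0 < r" "0 < s" "r + s < A"
  shows "kronecker A r s * theta A r * theta A s = kron_aux A r * theta A r * theta A (r + s)"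
  using kronecker_theta[OF assms] by (simp only: mult_ac)

text \<open>The double series is symmetric in \<open>r\<close> and \<open>s\<close>, and
  \<open>theta A (r + s)\<close> cancels. The common value, (Q)^3 in Kronecker's formula, can then
  be computed from a single convenient parameter.\<close>

lemma kron_aux_theta_eq:
  assumes "0 < r" "0 < s" "r + s < A"
  shows "kron_aux A r * theta A r = kron_aux A s * theta A s"
proof -
  have "kron_aux A r * theta A r * theta A (r + s) = kronecker A r s * theta A r * theta A s"
    by (rule kronecker_mult_theta[OF assms, symmetric])
  also have "\<dots> = kronecker A s r * theta A s * theta A r"
    by (simp only: kronecker_commute mult_ac)
  also have "\<dots> = kron_aux A s * theta A s * theta A (s + r)"
    by (rule kronecker_mult_theta) (use assms in auto)
  finally show ?thesis using assms by (simp add: add.commute)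
qed

text \<open>For equal parameters, swapping \<open>i\<close> and \<open>j\<close> preserves the
  weight, so only the diagonal survives modulo 2. There the weight is the quadratic form of a theta
  series, evaluated at \<open>- i\<close>.\<close>

lemma kronecker_diagonal:
  assumes "0 < r" "2 * r < A"
  shows "kronecker A r r = theta (2 * A) (A - 2 * r)"
proof -
  let ?w = "\<lambda>(i, j). int A * (i * j) + int r * i + int r * j"
  let ?D = "range (\<lambda>n. (n, n)) :: (int \<times> int) set"
  have g: "graded same_sign ?w" by (rule graded_kronecker) (use assms in auto)
  have sub: "?D \<subseteq> same_sign" by (auto simp: same_sign_def)
  have gD: "graded ?D ?w"
  proof (rule gradedI)
    show "?w x \<ge> 0" if "x \<in> ?D" for x using gradedD(1)[OF g, of x] that sub by blast
    have "{x \<in> ?D. ?w x = n} \<subseteq> {x \<in> same_sign. ?w x = n}" for n using sub by blast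
    thus "finite {x \<in> ?D. ?w x = n}" for n using gradedD(2)[OF g] finite_subset by blast
  qed
  have "kronecker A r r = gf ?D ?w"
    unfolding kronecker_def
  proof (rule gf_eq_by_involution[OF g gD, where f = prod.swap])
    fix x assume x: "x \<in> same_sign - ?D \<union> (?D - same_sign)"
    obtain i j where ij: "x = (i, j)" by (cases x)
    have "(i, j) \<in> same_sign" "i \<noteq> j" using x sub by (auto simp: ij)
    hence "(j, i) \<in> same_sign - ?D" by (auto simp: same_sign_def)
    thus "prod.swap x \<in> same_sign - ?D \<union> (?D - same_sign) \<and> prod.swap (prod.swap x) = x
        \<and> prod.swap x \<noteq> x \<and> ?w (prod.swap x) = ?w x"
      using \<open>i \<noteq> j\<close> by (simp add: ij mult.commute)
  qed
  also have "\<dots> = theta (2 * A) (A - 2 * r)"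
    unfolding theta_def
  proof (rule gf_bij[where f = "\<lambda>(i, j). - i"])
    show "bij_betw (\<lambda>(i, j). - i) ?D UNIV"
      by (rule bij_betw_byWitness[where f' = "\<lambda>n. (- n, - n)"]) auto
    fix x assume "x \<in> ?D"
    then obtain n where "x = (n, n)" by auto
    moreover have "int (2 * A) * tri (- n) = int A * (n * (n + 1))"
      using tri[of "- n"] by (simp add: algebra_simps)
    ultimately show "int (2 * A) * tri (case x of (i, j) \<Rightarrow> - i) + int (A - 2 * r) * (case x of (i, j) \<Rightarrow> - i) = ?w x"
      using assms by (simp add: of_nat_diff algebra_simps)
  qed
  finally show ?thesis .
qed

section \<open>Theta function identities\<close>

lemma graded_subset: "graded T w \<Longrightarrow> S \<subseteq> T \<Longrightarrow> graded S w"
proof (rule gradedI)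
  assume g: "graded T w" and sub: "S \<subseteq> T"
  show "w x \<ge> 0" if "x \<in> S" for x using gradedD(1)[OF g, of x] sub that by blast
  fix n
  have "{x \<in> S. w x = n} \<subseteq> {x \<in> T. w x = n}" using sub by blast
  thus "finite {x \<in> S. w x = n}" using gradedD(2)[OF g] finite_subset by blast
qed

lemma gf_int_residues:
  fixes w :: "int \<Rightarrow> int"
  assumes "graded UNIV w" "k > 0"
  shows "gf UNIV w = (\<Sum>c<k. gf UNIV (\<lambda>m. w (int k * m + int c)))"
proof -
  have "gf {n. nat (n mod int k) < l} w = (\<Sum>c<l. gf UNIV (\<lambda>m. w (int k * m + int c)))" if "l \<le> k" for l
    using that
  proof (induction l)
    case 0
    show ?case by (simp add: gf_def fps_zero_def)
  next
    case (Suc l)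
    have "{n. nat (n mod int k) < Suc l} = {n. nat (n mod int k) < l} \<union> {n. nat (n mod int k) = l}" by auto
    also have "gf \<dots> w = gf {n. nat (n mod int k) < l} w + gf {n. nat (n mod int k) = l} w"
      by (rule gf_union) (auto intro: graded_subset[OF assms(1)])
    also have "gf {n. nat (n mod int k) = l} w = gf UNIV (\<lambda>m. w (int k * m + int l))"
    proof (rule gf_bij[symmetric])
      show "bij_betw (\<lambda>m. int k * m + int l) UNIV {n. nat (n mod int k) = l}"
      proof (rule bij_betw_byWitness[where f' = "\<lambda>n. n div int k"])
        show "\<forall>n\<in>{n. nat (n mod int k) = l}. int k * (n div int k) + int l = n"
          using assms(2) by (auto simp: mult_div_mod_eq)
      qed (use Suc.prems in auto)
    qed simp
    finally show ?case using Suc by simp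
  qed
  from this[of k] have "gf {n. nat (n mod int k) < k} w = (\<Sum>c<k. gf UNIV (\<lambda>m. w (int k * m + int c)))" by simp
  moreover have "{n. nat (n mod int k) < k} = UNIV"
    using assms(2) by (auto simp: nat_less_iff)
  ultimately show ?thesis by simp
qed

lemma gf_theta_shift:
  assumes "0 < r" "r < A"
  shows "gf UNIV (\<lambda>m. int A * tri m + int r * m + int k) = fps_X ^ k * theta A r"
  unfolding theta_def by (rule gf_shift[OF graded_theta[OF assms], symmetric])

lemma tri_2_3:
  "tri (2 * m) = 4 * tri m + m" "tri (2 * m + 1) = 4 * tri m + 3 * m"
  "tri (3 * m) = 9 * tri m + 3 * m" "tri (3 * m + 1) = 9 * tri m + 6 * m" "tri (3 * m + 2) = 9 * tri m + 9 * m + 1"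
  by (rule tri_eqI; use tri[of m] in \<open>simp add: algebra_simps\<close>)+

lemma theta_residues_2:
  assumes "0 < r" "2 * r < A"
  shows "theta A r = theta (4 * A) (A + 2 * r) + fps_X ^ r * theta (4 * A) (3 * A + 2 * r)"
proof -
  let ?w = "\<lambda>n. int A * tri n + int r * n"
  have "graded UNIV ?w" by (rule graded_theta) (use assms in auto)
  moreover have "{..<2} = {0, 1 :: nat}" by auto
  ultimately have "theta A r = gf UNIV (\<lambda>m. ?w (2 * m)) + gf UNIV (\<lambda>m. ?w (2 * m + 1))"
    unfolding theta_def using gf_int_residues[of ?w 2] by simp
  also have "(\<lambda>m. ?w (2 * m)) = (\<lambda>m. int (4 * A) * tri m + int (A + 2 * r) * m)"
    unfolding tri_2_3 by (simp add: algebra_simps)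
  also have "(\<lambda>m. ?w (2 * m + 1)) = (\<lambda>m. int (4 * A) * tri m + int (3 * A + 2 * r) * m + int r)"
    unfolding tri_2_3 by (simp add: algebra_simps)
  also have "gf UNIV (\<lambda>m. int (4 * A) * tri m + int (3 * A + 2 * r) * m + int r)
      = fps_X ^ r * theta (4 * A) (3 * A + 2 * r)"
    by (rule gf_theta_shift) (use assms in auto)
  finally show ?thesis by (simp only: theta_def)
qed

lemma theta_residues_3:
  assumes "0 < r" "r < A"
  shows "theta A r = theta (9 * A) (3 * A + 3 * r) + fps_X ^ r * theta (9 * A) (6 * A + 3 * r)
    + fps_X ^ (A - r) * theta (9 * A) (3 * r)"
proof -
  let ?w = "\<lambda>n. int A * tri n + int r * n"
  have "theta A r = gf UNIV (\<lambda>m. ?w (3 * m)) + gf UNIV (\<lambda>m. ?w (3 * m + 1)) + gf UNIV (\<lambda>m. ?w (3 * m + 2))"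
  proof -
    have "{..<3} = {0, 1, 2 :: nat}" by auto
    thus ?thesis
      unfolding theta_def using gf_int_residues[OF graded_theta[OF assms], of 3] by (simp add: add.assoc)
  qed
  \<comment> \<open>The class of 2 is represented by -1: the representative 2 would give the theta
    parameter \<open>9 * A + 3 * r\<close>, which exceeds \<open>9 * A\<close>.\<close>
  also have "gf UNIV (\<lambda>m. ?w (3 * m + 2)) = gf UNIV (\<lambda>m. ?w (3 * m - 1))"
    by (rule gf_bij[where f = "\<lambda>m. m + 1"])
      (auto intro!: bij_betw_byWitness[where f' = "\<lambda>m. m - 1"] simp: algebra_simps)
  also have "(\<lambda>m. ?w (3 * m - 1)) = (\<lambda>m. int (9 * A) * tri m + int (3 * r) * m + int (A - r))"
  proof
    fix m
    have "tri (3 * m - 1) = 9 * tri m + 1"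
      by (rule tri_eqI) (use tri[of m] in \<open>simp add: algebra_simps\<close>)
    thus "?w (3 * m - 1) = int (9 * A) * tri m + int (3 * r) * m + int (A - r)"
      using assms by (simp add: of_nat_diff algebra_simps)
  qed
  also have "(\<lambda>m. ?w (3 * m)) = (\<lambda>m. int (9 * A) * tri m + int (3 * A + 3 * r) * m)"
    unfolding tri_2_3 by (simp add: algebra_simps)
  also have "(\<lambda>m. ?w (3 * m + 1)) = (\<lambda>m. int (9 * A) * tri m + int (6 * A + 3 * r) * m + int r)"
    unfolding tri_2_3 by (simp add: algebra_simps)
  also have "gf UNIV (\<lambda>m. int (9 * A) * tri m + int (6 * A + 3 * r) * m + int r)
      = fps_X ^ r * theta (9 * A) (6 * A + 3 * r)"
    by (rule gf_theta_shift) (use assms in auto)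
  also have "gf UNIV (\<lambda>m. int (9 * A) * tri m + int (3 * r) * m + int (A - r))
      = fps_X ^ (A - r) * theta (9 * A) (3 * r)"
    by (rule gf_theta_shift) (use assms in auto)
  finally show ?thesis by (simp only: theta_def)
qed

lemma theta_square:
  assumes "0 < r" "r < A"
  shows "theta (2 * A) (2 * r) = theta A r ^ 2"
proof -
  have "2 * A - 2 * r = 2 * (A - r)" by simp
  thus ?thesis
    using assms euler_square[of A r] euler_square[of A "A - r"] euler_square[of A A]
    by (simp add: Jacobi_triple_product power_mult_distrib)
qed

section \<open>Theta series as quotients of Euler products\<close>

lemma euler_split_2:
  assumes "A > 0" "r > 0"
  shows "euler A r = euler (2 * A) r * euler (2 * A) (A + r)"
proof -
  have "{..<2} = {0, 1 :: nat}" by auto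
  thus ?thesis using euler_split[OF assms, of 2] by (simp add: mult.commute)
qed

lemma euler_split_3:
  assumes "A > 0" "r > 0"
  shows "euler A r = euler (3 * A) r * euler (3 * A) (A + r) * euler (3 * A) (2 * A + r)"
proof -
  have "{..<3} = {0, 1, 2 :: nat}" by auto
  thus ?thesis using euler_split[OF assms, of 3] by (simp add: mult.commute mult.assoc)
qed

text \<open>In \<open>euler k k\<close> the even multiples of \<open>k\<close> contribute its
  square, by Frobenius; one factor cancels.\<close>

lemma euler_odd_inverse:
  assumes "k > 0"
  shows "euler (2 * k) k * euler k k = 1"
proof -
  have "euler k k = euler (2 * k) k * euler (2 * k) (2 * k)"
    using euler_split_2[OF assms assms] by (simp only: mult_2)
  also have "euler (2 * k) (2 * k) = euler k k ^ 2" by (rule euler_square[OF assms assms])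
  finally have "euler k k * 1 = euler k k * (euler (2 * k) k * euler k k)"
    by (simp add: power2_eq_square mult_ac)
  thus ?thesis by (simp only: mult_left_cancel[OF euler_nonzero])
qed

text \<open>Euler's pentagonal number theorem in q^k: the triple product collects the classes of k,
  2k and 3k modulo 3k.\<close>

lemma theta_3:
  assumes "k > 0"
  shows "theta (3 * k) k = euler k k"
proof -
  have "k + k = 2 * k" by simp
  with euler_split_3[OF assms assms] Jacobi_triple_product[of k "3 * k"] assms
  show ?thesis by simp
qed

text \<open>Jacobi's formula for the cube of the Euler product, modulo 2: the exponents n(2n - 1)
  run once through the triangular numbers, whose coefficients are odd.\<close>

lemma theta_4:
  assumes "k > 0"
  shows "theta (4 * k) k = euler k k ^ 3"
proof -
  have "theta (4 * k) k = euler (4 * k) k * euler (4 * k) (3 * k) * euler (4 * k) (4 * k)"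
    using assms by (simp add: Jacobi_triple_product)
  also have "euler (4 * k) k * euler (4 * k) (3 * k) = euler (2 * k) k"
    using euler_split_2[of "2 * k" k] assms by simp
  also have "euler (4 * k) (4 * k) = (euler k k ^ 2) ^ 2"
    using euler_square[of k k] euler_square[of "2 * k" "2 * k"] assms by simp
  also have "euler (2 * k) k * (euler k k ^ 2) ^ 2 = (euler (2 * k) k * euler k k) * euler k k ^ 3"
    by (simp add: power2_eq_square power3_eq_cube mult_ac)
  finally show ?thesis using assms by (simp add: euler_odd_inverse)
qed

text \<open>The odd multiples of \<open>k\<close> form the classes of k, 3k and 5k modulo 6k. The
  middle class and the product of all three are inverted by \<open>euler_odd_inverse\<close>. The
  cases \<open>k = 3\<close> and \<open>k = 9\<close> are needed.\<close>

lemma theta_6: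
  assumes "k > 0"
  shows "theta (6 * k) k * euler k k = euler (3 * k) (3 * k) ^ 3"
proof -
  let ?E = "\<lambda>r. euler (6 * k) (r * k)" and ?f = "euler k k" and ?g = "euler (3 * k) (3 * k)"
  have 1: "euler (2 * k) k = ?E 1 * ?E 3 * ?E 5"
    using euler_split_3[of "2 * k" k] assms by simp
  have 2: "?E 3 * ?g = 1" using euler_odd_inverse[of "3 * k"] assms by simp
  have 3: "?E 6 = ?g ^ 2" using euler_square[of "3 * k" "3 * k"] assms by simp
  have "theta (6 * k) k * ?f = ?E 1 * ?E 5 * ?g ^ 2 * ?f * (?E 3 * ?g)"
    using assms by (simp add: Jacobi_triple_product 2 3[symmetric])
  also have "\<dots> = (euler (2 * k) k * ?f) * ?g ^ 3"
    unfolding 1 by (simp add: power2_eq_square power3_eq_cube mult_ac)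
  finally show ?thesis using assms by (simp add: euler_odd_inverse)
qed

section \<open>Dissections of Euler products and the derivative of B\<close>

abbreviation f1 :: "bit fps" where "f1 \<equiv> euler 1 1"
abbreviation f3 :: "bit fps" where "f3 \<equiv> euler 3 3"
abbreviation f9 :: "bit fps" where "f9 \<equiv> euler 9 9"
abbreviation f27 :: "bit fps" where "f27 \<equiv> euler 27 27"

text \<open>The three-dissection of the pentagonal series. Its theta functions are those that appear
  as denominators in \<open>lambert_eq\<close>.\<close>

lemma f1_residues_3: "f1 = theta 27 12 + fps_X * theta 27 6 + fps_X ^ 2 * theta 27 3"
  using theta_3[of 1] theta_residues_3[of 1 3] theta_reflect[of 6 27] by simp

text \<open>The cube is the series of triangular numbers. Those congruent to 1 modulo 3 have the
  form 9t + 1 with t triangular and give the last term; the other two classes are the two-dissection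
  of the pentagonal series of \<open>f3\<close>.\<close>

lemma f1_cube: "f1 ^ 3 = f3 + fps_X * f9 ^ 3"
proof -
  have "f1 ^ 3 = theta 36 15 + fps_X * theta 36 27 + fps_X ^ 3 * theta 36 3"
    using theta_4[of 1] theta_residues_3[of 1 4] by simp
  moreover have "f3 = theta 36 15 + fps_X ^ 3 * theta 36 3"
    using theta_3[of 3] theta_residues_2[of 3 9] theta_reflect[of 3 36] by simp
  moreover have "theta 36 27 = f9 ^ 3"
    using theta_4[of 9] theta_reflect[of 9 36] by simp
  ultimately show ?thesis by (simp add: add_ac)
qed

lemma f9_cube: "theta 18 3 * f3 = f9 ^ 3"
  using theta_6[of 3] by simp

text \<open>Two applications of Frobenius turn \<open>theta 72 12\<close> into the fourth power of
  \<open>theta 18 3\<close>. The two-dissection is thus a square plus q times a square, and only the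
  second summand has a derivative.\<close>

lemma deriv_theta_18_3: "fps_deriv (theta 18 3) = fps_X ^ 2 * theta 18 3 ^ 4"
proof -
  have "theta 18 3 = theta 72 24 + fps_X ^ 3 * theta 72 12"
    using theta_residues_2[of 3 18] theta_reflect[of 12 72] by simp
  moreover have "theta 72 24 = theta 36 12 ^ 2" using theta_square[of 12 36] by simp
  moreover have "theta 72 12 = (theta 18 3 ^ 2) ^ 2"
    using theta_square[of 3 18] theta_square[of 6 36] by simp
  ultimately have "theta 18 3 = theta 36 12 ^ 2 * 1 + (fps_X * theta 18 3 ^ 2) ^ 2 * fps_X"
    by (simp add: power_mult_distrib power2_eq_square power3_eq_cube mult_ac)
  from arg_cong[OF this, of fps_deriv]
  have "fps_deriv (theta 18 3) = fps_deriv (theta 36 12 ^ 2 * 1 + (fps_X * theta 18 3 ^ 2) ^ 2 * fps_X)" .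
  also have "\<dots> = (fps_X * theta 18 3 ^ 2) ^ 2"
    by (simp only: fps_deriv_add bit_fps_deriv_square_mult fps_deriv_fps_X) simp
  also have "\<dots> = fps_X ^ 2 * theta 18 3 ^ 4"
    by (simp add: power_mult_distrib flip: power_mult)
  finally show ?thesis .
qed

text \<open>A residue pair (x, y) modulo 9 with xy = 3k + 2 corresponds to
  \<open>fps_X ^ k * kronecker 27 (3 * y) (3 * x)\<close>; the pairs here are (2, 1), (5, 1) and (2,
  4).\<close>

definition lambert :: "bit fps" where
  "lambert = kronecker 27 3 6 + fps_X * kronecker 27 3 15 + fps_X ^ 2 * kronecker 27 12 6"

text \<open>In all three terms \<open>r + s\<close> is 9 or 18, and both theta functions equal
  \<open>f9\<close>, so the three quotients have the same numerator. Over the common denominator the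
  dissection of \<open>f1\<close> appears.\<close>

lemma lambert_eq: "lambert * f3 = f1 * f9 ^ 2"
proof -
  let ?T = "theta 27"
  define \<kappa> where "\<kappa> = kron_aux 27 3 * ?T 3"
  have T18: "?T 18 = ?T 9" and T15: "?T 15 = ?T 12" using theta_reflect[of 9 27] theta_reflect[of 12 27] by simp_all
  have T9: "?T 9 = f9" using theta_3[of 9] by simp
  \<comment> \<open>The constant is evaluated at \<open>r = s = 9\<close>, where the double series
    collapses to its diagonal.\<close>
  have "kron_aux 27 9 * ?T 9 = \<kappa>" unfolding \<kappa>_def by (rule kron_aux_theta_eq) auto
  hence "kronecker 27 9 9 * ?T 9 = \<kappa>"
    using kronecker_theta[of 9 9 27] by (simp add: T18)
  moreover have "kronecker 27 9 9 = theta 54 9" using kronecker_diagonal[of 9 27] by simp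
  moreover have "theta 54 9 * f9 = f27 ^ 3" using theta_6[of 9] by simp
  ultimately have \<kappa>: "\<kappa> = f27 ^ 3" by (simp add: T9)
  have "kron_aux 27 12 * ?T 12 = \<kappa>" unfolding \<kappa>_def by (rule kron_aux_theta_eq) auto
  hence k1: "kronecker 27 12 6 * ?T 12 * ?T 6 = \<kappa> * f9"
    using kronecker_mult_theta[of 12 6 27] by (simp add: T18 T9)
  have k2: "kronecker 27 3 6 * ?T 3 * ?T 6 = \<kappa> * f9"
    using kronecker_mult_theta[of 3 6 27] by (simp add: T9 \<kappa>_def)
  have k3: "kronecker 27 3 15 * ?T 3 * ?T 12 = \<kappa> * f9"
    using kronecker_mult_theta[of 3 15 27] by (simp add: T18 T9 T15 \<kappa>_def)
  have "lambert * (?T 3 * ?T 6 * ?T 12) =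
     (kronecker 27 3 6 * ?T 3 * ?T 6) * ?T 12 + fps_X * (kronecker 27 3 15 * ?T 3 * ?T 12) * ?T 6
     + fps_X ^ 2 * (kronecker 27 12 6 * ?T 12 * ?T 6) * ?T 3"
    by (simp only: lambert_def distrib_left distrib_right mult_ac)
  also have "\<dots> = \<kappa> * f9 * f1"
    unfolding k1 k2 k3 f1_residues_3 by (simp add: distrib_left mult_ac)
  finally have L: "lambert * (?T 3 * ?T 6 * ?T 12) = f27 ^ 3 * f9 * f1" unfolding \<kappa> .
  \<comment> \<open>The nonzero multiples of 3 modulo 27 form the pairs {3, 24}, {6, 21}, {9, 18}
    and {12, 15}, one for each theta function. Each triple product brings a factor
    \<open>f27\<close>, of which \<open>f3\<close> accounts for only one.\<close>
  have "f3 = (\<Prod>s<9. euler 27 (3 * s + 3))" using euler_split[of 3 3 9] by simp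
  hence "?T 3 * ?T 6 * ?T 12 * ?T 9 = f3 * f27 ^ 3"
    by (simp add: Jacobi_triple_product eval_nat_numeral mult_ac)
  hence "lambert * (f3 * f27 ^ 3) = (lambert * (?T 3 * ?T 6 * ?T 12)) * f9"
    by (simp only: T9 mult_ac)
  hence "(lambert * f3) * f27 ^ 3 = (f1 * f9 ^ 2) * f27 ^ 3"
    unfolding L by (simp only: power2_eq_square mult_ac)
  moreover have "f27 ^ 3 \<noteq> 0" by simp
  ultimately show ?thesis using mult_right_cancel by blast
qed

text \<open>Multiplying \<open>B\<close> by the fourth power of \<open>f1\<close>, a constant for
  the derivation, turns it into \<open>f9 * f1 ^ 3\<close>, to which \<open>f1_cube\<close> applies.
  After differentiation the terms recombine by the square of \<open>f1_cube\<close>.\<close>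

lemma deriv_quotient:
  assumes "B * f1 = f9"
  shows "fps_deriv B = lambert ^ 2"
proof -
  let ?P = "theta 18 3"
  \<comment> \<open>Up to square factors \<open>f9 * f3\<close> is \<open>theta 18 3\<close>, whose
    derivative is known.\<close>
  have "fps_deriv (f9 ^ 2 * (f9 * f3)) = fps_deriv (f3 ^ 2 * ?P)"
    by (rule arg_cong[of _ _ fps_deriv])
      (use f9_cube in \<open>simp only: power2_eq_square power3_eq_cube mult_ac\<close>)
  hence 1: "f9 ^ 2 * fps_deriv (f9 * f3) = f3 ^ 2 * (fps_X ^ 2 * ?P ^ 4)"
    by (simp only: bit_fps_deriv_square_mult deriv_theta_18_3)
  have "(f1 ^ 2) ^ 2 * B = f9 * f1 ^ 3"
    unfolding assms[symmetric] by (simp add: power2_eq_square power3_eq_cube mult_ac)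
  also have "\<dots> = f9 * f3 + (f9 ^ 2) ^ 2 * fps_X"
    unfolding f1_cube by (simp add: distrib_left power2_eq_square power3_eq_cube mult_ac)
  finally have "fps_deriv ((f1 ^ 2) ^ 2 * B) = fps_deriv (f9 * f3 + (f9 ^ 2) ^ 2 * fps_X)"
    by (rule arg_cong)
  hence 2: "(f1 ^ 2) ^ 2 * fps_deriv B = fps_deriv (f9 * f3) + (f9 ^ 2) ^ 2"
    by (simp only: fps_deriv_add bit_fps_deriv_square_mult fps_deriv_fps_X mult_1_right)
  have "(f1 ^ 2) ^ 2 * f9 ^ 2 * (f3 ^ 2 * fps_deriv B)
      = f3 ^ 2 * (f9 ^ 2 * fps_deriv (f9 * f3)) + f3 ^ 2 * f9 ^ 2 * (f9 ^ 2) ^ 2"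
    using arg_cong[OF 2, of "\<lambda>x. f9 ^ 2 * f3 ^ 2 * x"] by (simp only: distrib_left mult_ac)
  also have "f3 ^ 2 * (f9 ^ 2 * fps_deriv (f9 * f3)) = fps_X ^ 2 * (?P * f3) ^ 4"
    unfolding 1 by (simp add: power_mult_distrib eval_nat_numeral mult_ac)
  also have "\<dots> + f3 ^ 2 * f9 ^ 2 * (f9 ^ 2) ^ 2 = (f9 ^ 3) ^ 2 * (f3 ^ 2 + (fps_X * f9 ^ 3) ^ 2)"
    unfolding f9_cube by (simp add: power_mult_distrib distrib_left eval_nat_numeral mult_ac add_ac)
  also have "\<dots> = (f9 ^ 3) ^ 2 * (f1 ^ 3) ^ 2"
    by (simp only: bit_fps_square_add[symmetric] f1_cube)
  also have "\<dots> = (f1 ^ 2) ^ 2 * f9 ^ 2 * (f1 * f9 ^ 2) ^ 2"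
    by (simp add: power_mult_distrib eval_nat_numeral mult_ac)
  also have "(f1 * f9 ^ 2) ^ 2 = f3 ^ 2 * lambert ^ 2"
    by (simp only: lambert_eq[symmetric] power_mult_distrib mult.commute)
  finally show ?thesis by simp
qed

section \<open>Factor pairs and the congruence\<close>

lemma of_int_bit: "of_int k = (if even k then 0 else 1 :: bit)"
  by (cases "even k") (auto elim!: evenE oddE)

lemma of_int_bit_eq_of_nat_iff: "(of_int k :: bit) = of_nat m \<longleftrightarrow> even k = even m"
  by (simp add: of_int_bit of_nat_bit)

lemma fps_nth_prod_one_minus_of_int:
  assumes "finite I"
  shows "fps_nth (\<Prod>i\<in>I. 1 - fps_X ^ f i :: 'a :: comm_ring_1 fps) n
    = of_int (fps_nth (\<Prod>i\<in>I. 1 - fps_X ^ f i) n)"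
  using assms
proof (induction I arbitrary: n)
  case (insert x I)
  show ?case using insert.hyps
    by (simp add: left_diff_distrib fps_X_power_mult_nth insert.IH)
qed (simp add: fps_one_nth)

lemma b9_mult_euler: "Abs_fps (\<lambda>n. of_int (b9 n)) * f1 = f9"
proof (rule fps_ext)
  fix n
  let ?q = "\<lambda>i. (1 - fps_X ^ (9 * Suc i)) / (1 - fps_X ^ Suc i) :: rat fps"
  let ?u = "\<lambda>N. \<Prod>i\<in>{..N}. 1 - fps_X ^ Suc i" and ?v = "\<lambda>N. \<Prod>i\<in>{..N}. 1 - fps_X ^ (9 * Suc i)"
  have "(\<lambda>N. \<Prod>i\<le>N. ?q i) \<longlonglongrightarrow> Abs_fps (\<lambda>n. rat_of_int (b9 n))"
    by (rule has_prod_imp_tendsto[OF has_prod_b9])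
  hence "\<forall>\<^sub>F N in sequentially. \<forall>m\<in>{..n}. fps_nth (\<Prod>i\<le>N. ?q i) m = of_int (b9 m)"
    by (subst eventually_ball_finite_distrib) (auto simp: tendsto_fps_iff)
  hence "\<forall>\<^sub>F N in sequentially. N \<ge> n \<and> (\<forall>m\<in>{..n}. fps_nth (\<Prod>i\<le>N. ?q i) m = of_int (b9 m))"
    using eventually_ge_at_top by (rule eventually_conj[rotated])
  \<comment> \<open>Some partial product already has the right coefficients up to \<open>n\<close>;
    this leaves a finite identity with integer coefficients, which is read off over the rationals
    and then reduced modulo 2.\<close>
  then obtain N where N: "N \<ge> n" "\<And>m. m \<le> n \<Longrightarrow> fps_nth (\<Prod>i\<le>N. ?q i) m = of_int (b9 m)"
    by (auto simp: eventually_sequentially)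
  have "?q i * (1 - fps_X ^ Suc i) = 1 - fps_X ^ (9 * Suc i)" for i
  proof (rule dvd_div_mult_self)
    have "1 - (fps_X ^ Suc i) ^ 9 = (1 - fps_X ^ Suc i) * (\<Sum>j<9. (fps_X ^ Suc i) ^ j :: rat fps)"
      by (rule one_diff_power_eq)
    thus "(1 - fps_X ^ Suc i :: rat fps) dvd 1 - fps_X ^ (9 * Suc i)"
      by (metis dvd_triv_left power_mult mult.commute)
  qed
  hence "?v N = (\<Prod>i\<le>N. ?q i) * ?u N" by (simp only: prod.distrib[symmetric])
  hence "fps_nth (?v N :: rat fps) n = (\<Sum>m=0..n. fps_nth (\<Prod>i\<le>N. ?q i) m * fps_nth (?u N) (n - m))"
    by (simp only: fps_mult_nth)
  also have "\<dots> = (\<Sum>m=0..n. of_int (b9 m) * fps_nth (?u N) (n - m))"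
    by (rule sum.cong[OF refl]) (simp only: N(2) atLeastAtMost_iff)
  finally have "fps_nth (?v N :: rat fps) n = (\<Sum>m=0..n. of_int (b9 m) * fps_nth (?u N) (n - m))" .
  hence "rat_of_int (fps_nth (?v N) n) = of_int (\<Sum>m=0..n. b9 m * fps_nth (?u N) (n - m))"
    unfolding fps_nth_prod_one_minus_of_int[where 'a = rat, OF finite_atMost] by simp
  hence "(of_int (fps_nth (?v N) n) :: bit) = of_int (\<Sum>m=0..n. b9 m * fps_nth (?u N) (n - m))"
    by (simp only: of_int_eq_iff)
  hence *: "fps_nth (?v N :: bit fps) n = (\<Sum>m=0..n. of_int (b9 m) * fps_nth (?u N) (n - m))"
    unfolding fps_nth_prod_one_minus_of_int[where 'a = bit, OF finite_atMost] by simp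
  have euler: "fps_nth (\<Prod>i\<in>{..N}. 1 - fps_X ^ (A * Suc i)) m = fps_nth (euler A A) m"
    if "A > 0" "m \<le> n" for A m
    using euler_nth[of A A m "Suc N"] that N(1)
    by (simp only: bit_fps_diff lessThan_Suc_atMost mult_Suc_right add.commute[of A])
  show "fps_nth (Abs_fps (\<lambda>n. of_int (b9 n)) * f1) n = fps_nth f9 n"
    using * euler[of 9 n] euler[of 1] by (simp add: fps_mult_nth)
qed

text \<open>The products of the three residue pairs are 2, 5 and 8 modulo 9, so a given
  \<open>N\<close> admits at most one of them.\<close>

definition factor_pairs :: "int \<Rightarrow> (int \<times> int) set" where
  "factor_pairs N = {(d, e). d * e = N \<and> (d mod 9, e mod 9) \<in> {(2, 1), (5, 1), (2, 4)}}"

lemma finite_mult_eq: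
  assumes "N \<noteq> 0"
  shows "finite {(d, e). d * e = (N :: int)}"
proof (rule finite_subset)
  show "{(d, e). d * e = N} \<subseteq> {d. d dvd N} \<times> {e. e dvd N}" by auto
  show "finite ({d. d dvd N} \<times> {e. e dvd N})" using assms by (simp add: finite_divisors_int)
qed

lemma finite_factor_pairs: "N \<noteq> 0 \<Longrightarrow> finite (factor_pairs N)"
  by (rule finite_subset[OF _ finite_mult_eq[of N]]) (auto simp: factor_pairs_def)

text \<open>Putting d = 9i + x and e = 9j + y makes \<open>d * e\<close> equal to three times the
  shifted weight, plus 2.\<close>

lemma kronecker_27_nth:
  assumes "0 < x" "x < 9" "0 < y" "y < 9" "3 * x + 3 * y \<le> 27" "x * y = 3 * k + 2"
  shows "fps_nth (fps_X ^ k * kronecker 27 (3 * y) (3 * x)) n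
    = of_nat (card {(d, e). d * e = 3 * int n + 2 \<and> (d mod 9, e mod 9) = (int x, int y)})"
proof -
  let ?w = "\<lambda>(i, j). int 27 * (i * j) + int (3 * y) * i + int (3 * x) * j"
  have xy: "int x * int y = 3 * int k + 2" using assms(6) by (metis of_nat_add of_nat_mult of_nat_numeral)
  have eq: "(9 * i + int x) * (9 * j + int y) = 3 * (?w (i, j) + int k) + 2" for i j
    using xy by (simp add: algebra_simps)
  have "bij_betw (\<lambda>(i, j). (9 * i + int x, 9 * j + int y)) {z \<in> same_sign. ?w z + int k = int n}
      {(d, e). d * e = 3 * int n + 2 \<and> (d mod 9, e mod 9) = (int x, int y)}" (is "bij_betw ?f ?S ?T")
  proof (rule bij_betw_byWitness[where f' = "\<lambda>(d, e). (d div 9, e div 9)"])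
    show "\<forall>z\<in>?T. ?f (case z of (d, e) \<Rightarrow> (d div 9, e div 9)) = z"
      by (auto simp: mult_div_mod_eq) (metis mult_div_mod_eq)+
    show "?f ` ?S \<subseteq> ?T"
    proof (rule image_subsetI)
      fix z assume z: "z \<in> ?S"
      obtain i j where ij: "z = (i, j)" by (cases z)
      have "?w (i, j) + int k = int n" using z ij by simp
      thus "?f z \<in> ?T" using eq[of i j] assms by (simp add: ij)
    qed
    show "(\<lambda>(d, e). (d div 9, e div 9)) ` ?T \<subseteq> ?S"
    proof (rule image_subsetI)
      fix z assume z: "z \<in> ?T"
      obtain d e where de: "z = (d, e)" by (cases z)
      define i j where "i = d div 9" and "j = e div 9"
      have d: "d = 9 * i + int x" "e = 9 * j + int y"
        using z de by (auto simp: i_def j_def) (metis mult_div_mod_eq)+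
      have n: "d * e = 3 * int n + 2" using z de by simp
      hence pos: "d * e > 0" by simp
      \<comment> \<open>Since the residues lie strictly between 0 and 9, \<open>d\<close> is
        positive exactly if \<open>i \<ge> 0\<close>, and likewise for \<open>e\<close> and
        \<open>j\<close>. A positive product therefore means a pair in
        \<open>same_sign\<close>.\<close>
      hence "(0 < d) = (0 < e)" by (auto simp: zero_less_mult_iff)
      hence "(0 \<le> i) = (0 \<le> j)" using d assms by linarith
      moreover have "?w (i, j) + int k = int n" using eq[of i j] n unfolding d by simp
      ultimately show "(case z of (d, e) \<Rightarrow> (d div 9, e div 9)) \<in> ?S"
        by (simp add: de same_sign_def flip: i_def j_def)
    qed
  qed (use assms in auto)
  hence "card ?S = card ?T" by (rule bij_betw_same_card)
  moreover have "fps_X ^ k * kronecker 27 (3 * y) (3 * x) = gf same_sign (\<lambda>z. ?w z + int k)"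
    unfolding kronecker_def by (rule gf_shift, rule graded_kronecker) (use assms in auto)
  ultimately show ?thesis by (simp only: gf_nth)
qed

lemma lambert_nth: "fps_nth lambert n = of_nat (card (factor_pairs (3 * int n + 2)))"
proof -
  define T where "T c = {(d, e). d * e = 3 * int n + 2 \<and> (d mod 9, e mod 9) = (c :: int \<times> int)}" for c
  have fin: "finite (T c)" for c
    unfolding T_def by (rule finite_subset[OF _ finite_mult_eq[of "3 * int n + 2"]]) auto
  have disj: "T c \<inter> T c' = {}" if "c \<noteq> c'" for c c'
    using that by (auto simp: T_def)
  have "factor_pairs (3 * int n + 2) = T (2, 1) \<union> T (5, 1) \<union> T (2, 4)"
    by (auto simp: factor_pairs_def T_def)
  also have "card \<dots> = card (T (2, 1) \<union> T (5, 1)) + card (T (2, 4))"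
    by (intro card_Un_disjoint finite_UnI fin) (simp add: Int_Un_distrib2 disj)
  also have "card (T (2, 1) \<union> T (5, 1)) = card (T (2, 1)) + card (T (5, 1))"
    by (intro card_Un_disjoint fin disj) simp
  finally have "(of_nat (card (factor_pairs (3 * int n + 2))) :: bit)
      = of_nat (card (T (2, 1))) + of_nat (card (T (5, 1))) + of_nat (card (T (2, 4)))"
    by (simp only: of_nat_add)
  moreover have "fps_nth (fps_X ^ 0 * kronecker 27 3 6) n = of_nat (card (T (2, 1)))"
    using kronecker_27_nth[of 2 1 0 n] by (simp add: T_def)
  moreover have "fps_nth (fps_X ^ 1 * kronecker 27 3 15) n = of_nat (card (T (5, 1)))"
    using kronecker_27_nth[of 5 1 1 n] by (simp add: T_def)
  moreover have "fps_nth (fps_X ^ 2 * kronecker 27 12 6) n = of_nat (card (T (2, 4)))"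
    using kronecker_27_nth[of 2 4 2 n] by (simp add: T_def)
  ultimately show ?thesis
    by (simp only: lambert_def fps_add_nth power_0 power_one_right mult_1_left)
qed

text \<open>The coefficient of index \<open>2 * m\<close> in the derivative is (2m + 1) times that
  of index 2m + 1, and the factor is odd. In the square of \<open>lambert\<close> it is the
  coefficient of index \<open>m\<close>.\<close>

theorem even_b9_iff: "even (b9 (2 * m + 1)) \<longleftrightarrow> even (card (factor_pairs (3 * int m + 2)))"
proof -
  let ?B = "Abs_fps (\<lambda>n. of_int (b9 n)) :: bit fps"
  have "fps_nth (fps_deriv ?B) (2 * m) = fps_nth lambert m"
    unfolding deriv_quotient[OF b9_mult_euler] by (rule bit_fps_square_nth)
  moreover have "fps_nth (fps_deriv ?B) (2 * m) = of_int (b9 (2 * m + 1))"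
    by (simp add: of_nat_bit)
  ultimately have "(of_int (b9 (2 * m + 1)) :: bit) = of_nat (card (factor_pairs (3 * int m + 2)))"
    by (simp only: lambert_nth)
  thus ?thesis by (simp only: of_int_bit_eq_of_nat_iff)
qed

text \<open>A factorization of \<open>P * N\<close> has \<open>P\<close> in the first factor
  (\<open>A\<close>) or in the second (\<open>B\<close>), and removing it leaves the residues modulo
  9 unchanged. Those in both sets come from \<open>N div P\<close>. \<open>P\<close> may be
  negative, whence \<open>prime_elem\<close>.\<close>

lemma card_factor_pairs_prime_mult:
  fixes P N :: int
  assumes P: "prime_elem P" "P mod 9 = 1" and N: "N \<noteq> 0"
  shows "card (factor_pairs (P * N)) + (if P dvd N then card (factor_pairs (N div P)) else 0)
    = 2 * card (factor_pairs N)"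
proof -
  have P0: "P \<noteq> 0" using P(1) by auto
  have mod: "P * d mod 9 = d mod 9" for d
    using P(2) by (metis mod_mult_left_eq mult_1)
  define A where "A = (\<lambda>(d, e). (P * d, e)) ` factor_pairs N"
  define B where "B = (\<lambda>(d, e). (d, P * e)) ` factor_pairs N"
  have fin: "finite A" "finite B" using finite_factor_pairs[OF N] by (simp_all add: A_def B_def)
  have cA: "card A = card (factor_pairs N)" unfolding A_def
    by (rule card_image) (use P0 in \<open>auto simp: inj_on_def\<close>)
  have cB: "card B = card (factor_pairs N)" unfolding B_def
    by (rule card_image) (use P0 in \<open>auto simp: inj_on_def\<close>)
  have "factor_pairs (P * N) = A \<union> B"
  proof
    show "factor_pairs (P * N) \<subseteq> A \<union> B"
    proof
      fix z assume z: "z \<in> factor_pairs (P * N)"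
      obtain d e where de: "z = (d, e)" by (cases z)
      have "d * e = P * N" using z by (simp add: de factor_pairs_def)
      hence "P dvd d \<or> P dvd e" using P(1) by (metis dvd_triv_left prime_elem_dvd_mult_iff)
      thus "z \<in> A \<union> B"
      proof
        assume "P dvd d"
        then obtain d' where d: "d = P * d'" by blast
        hence "(d', e) \<in> factor_pairs N" using z P0 by (auto simp: de factor_pairs_def mod mult.assoc)
        thus ?thesis by (force simp: A_def de d)
      next
        assume "P dvd e"
        then obtain e' where e: "e = P * e'" by blast
        hence "(d, e') \<in> factor_pairs N" using z P0 by (auto simp: de factor_pairs_def mod mult.left_commute)
        thus ?thesis by (force simp: B_def de e)
      qed
    qed
    show "A \<union> B \<subseteq> factor_pairs (P * N)"
      by (auto simp: A_def B_def factor_pairs_def mod)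
  qed
  moreover have "card A + card B = card (A \<union> B) + card (A \<inter> B)"
    by (rule card_Un_Int[OF fin])
  moreover have "card (A \<inter> B) = (if P dvd N then card (factor_pairs (N div P)) else 0)"
  proof (cases "P dvd N")
    case True
    then obtain M where M: "N = P * M" by blast
    have "A \<inter> B = (\<lambda>(d, e). (P * d, P * e)) ` factor_pairs M"
    proof
      show "A \<inter> B \<subseteq> (\<lambda>(d, e). (P * d, P * e)) ` factor_pairs M"
      proof
        fix z assume "z \<in> A \<inter> B"
        then obtain d e where z: "z = (P * d, P * e)" "(d, P * e) \<in> factor_pairs N"
          by (auto simp: A_def B_def)
        hence "(d, e) \<in> factor_pairs M" using P0 by (auto simp: factor_pairs_def mod M mult.left_commute)
        thus "z \<in> (\<lambda>(d, e). (P * d, P * e)) ` factor_pairs M" by (force simp: z)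
      qed
      show "(\<lambda>(d, e). (P * d, P * e)) ` factor_pairs M \<subseteq> A \<inter> B"
      proof (rule image_subsetI)
        fix z assume z: "z \<in> factor_pairs M"
        obtain d e where de: "z = (d, e)" by (cases z)
        have "(d, P * e) \<in> factor_pairs N" "(P * d, e) \<in> factor_pairs N"
          using z by (auto simp: de factor_pairs_def mod M)
        thus "(case z of (d, e) \<Rightarrow> (P * d, P * e)) \<in> A \<inter> B"
          by (force simp: A_def B_def de)
      qed
    qed
    moreover have "inj_on (\<lambda>(d, e). (P * d, P * e)) (factor_pairs M)"
      using P0 by (auto simp: inj_on_def)
    ultimately show ?thesis using True P0 by (simp add: card_image M)
  next
    case False
    have "A \<inter> B = {}"
    proof (rule ccontr)
      assume "A \<inter> B \<noteq> {}"
      then obtain d e where "(d, P * e) \<in> factor_pairs N"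
        by (auto simp: A_def B_def)
      hence "N = P * (d * e)" by (auto simp: factor_pairs_def)
      thus False using False by simp
    qed
    thus ?thesis using False by simp
  qed
  ultimately show ?thesis using cA cB by simp
qed

lemma factor_pairs_mod_3: "(d, e) \<in> factor_pairs N \<Longrightarrow> N mod 3 = 2"
proof -
  assume "(d, e) \<in> factor_pairs N"
  hence N: "N = d * e" and "d mod 9 \<in> {2, 5}" "e mod 9 \<in> {1, 4}" by (auto simp: factor_pairs_def)
  hence "d mod 3 = 2" "e mod 3 = 1" by (auto; presburger)+
  thus "N mod 3 = 2" unfolding N by (metis mod_mult_eq mult_1_right mod_mod_trivial)
qed

lemma fps_nth_compose_X_power:
  fixes F :: "'a :: comm_ring_1 fps"
  assumes "p > 0"
  shows "fps_nth (F oo fps_X ^ p) n = (if p dvd n then fps_nth F (n div p) else 0)"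
proof -
  have "fps_nth (F oo fps_X ^ p) n = (\<Sum>i\<in>{0..n}. if n = p * i then fps_nth F i else 0)"
    unfolding fps_compose_nth by (intro sum.cong refl) (simp add: fps_X_power_nth flip: power_mult)
  also have "\<dots> = (\<Sum>i\<in>{0..n}. if p dvd n \<and> n div p = i then fps_nth F i else 0)"
    by (intro sum.cong refl) (use assms in auto)
  also have "\<dots> = (if p dvd n then fps_nth F (n div p) else 0)"
    by (cases "p dvd n") simp_all
  finally show ?thesis .
qed

text \<open>The number \<open>k\<close> is chosen so that the index 2pn + \<alpha> corresponds to
  the argument p(3n + k) of \<open>factor_pairs\<close>. The correction term lives where (3n + k) /
  p is an integer of the form 3j + 2, and 3\<beta> + k = 2p translates this into n = \<beta> +
  pj.\<close>

theorem b9_congruence: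
  fixes p k \<alpha> \<beta> :: nat
  assumes p: "prime p" "int p mod 9 \<in> {1, 8}" and k: "3 * \<alpha> + 1 = 2 * p * k" "3 * \<beta> + k = 2 * p"
  shows "fps_cong (Abs_fps (\<lambda>n. b9 (2 * p * n + \<alpha>)))
           (fps_X ^ \<beta> * (Abs_fps (\<lambda>n. b9 (2 * n + 1)) oo fps_X ^ p)) 2"
  unfolding fps_cong_def
proof
  fix n
  \<comment> \<open>The sign makes \<open>P\<close> congruent to 1 modulo 9; \<open>N\<close>
    carries the same sign, so that \<open>P * N\<close> is positive.\<close>
  define s where "s = (if int p mod 9 = 1 then 1 else - 1 :: int)"
  define P where "P = s * int p"
  have s: "s * s = 1" by (simp add: s_def)
  have p0: "p > 0" using p(1) by (rule prime_gt_0_nat)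
  have k0: "k > 0" using k(1) by (cases k) auto
  have P: "prime_elem P" "P mod 9 = 1"
    using p(2) by (auto simp: P_def s_def p(1) prime_imp_prime_elem zmod_zminus1_eq_if)
  define N where "N = s * (3 * int n + int k)"
  have N0: "N \<noteq> 0" using k0 by (simp add: N_def s_def)
  have PN: "P * N = int p * (3 * int n + int k)"
    using s by (simp add: P_def N_def algebra_simps) (metis mult.left_commute mult_1_right)
  have "odd (3 * \<alpha>)" using k(1) by (metis even_Suc even_mult_iff dvd_triv_left Suc_eq_plus1 mult.assoc)
  then obtain a where a: "\<alpha> = 2 * a + 1" by (auto elim: oddE)
  have "3 * int (p * n + a) + 2 = int p * (3 * int n + int k)"
  proof -
    have "int (3 * \<alpha> + 1) = int (2 * p * k)" using k(1) by (simp only:)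
    thus ?thesis by (simp add: a algebra_simps)
  qed
  hence L: "even (b9 (2 * p * n + \<alpha>)) \<longleftrightarrow> even (card (factor_pairs (P * N)))"
  proof -
    have "2 * p * n + \<alpha> = 2 * (p * n + a) + 1" by (simp add: a algebra_simps)
    thus ?thesis using even_b9_iff[of "p * n + a"] \<open>3 * int (p * n + a) + 2 = _\<close> by (simp only: PN)
  qed
  define R where "R = (if P dvd N then card (factor_pairs (N div P)) else 0)"
  have "even (card (factor_pairs (P * N)) + R)"
    using card_factor_pairs_prime_mult[OF P N0] by (simp add: R_def)
  hence L: "even (b9 (2 * p * n + \<alpha>)) \<longleftrightarrow> even R" using L by simp
  have "even (fps_nth (fps_X ^ \<beta> * (Abs_fps (\<lambda>n. b9 (2 * n + 1)) oo fps_X ^ p)) n) \<longleftrightarrow> even R"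
  proof (cases "\<exists>j. n = \<beta> + p * j")
    case True
    then obtain j where j: "n = \<beta> + p * j" by blast
    have "3 * n + k = p * (3 * j + 2)" using k(2) by (simp add: j algebra_simps)
    hence "3 * int n + int k = int p * (3 * int j + 2)" by (metis of_nat_add of_nat_mult of_nat_numeral)
    hence "N = P * (3 * int j + 2)" by (simp add: N_def P_def)
    moreover have "P \<noteq> 0" using P(2) by auto
    ultimately have "R = card (factor_pairs (3 * int j + 2))" by (simp add: R_def)
    moreover have "fps_nth (fps_X ^ \<beta> * (Abs_fps (\<lambda>n. b9 (2 * n + 1)) oo fps_X ^ p)) n = b9 (2 * j + 1)"
      using p0 by (simp add: j fps_X_power_mult_nth fps_nth_compose_X_power)
    ultimately show ?thesis using even_b9_iff[of j] by simp
  next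
    case False
    have "R = 0"
    proof (rule ccontr)
      \<comment> \<open>A factor pair of \<open>N div P\<close> forces this quotient to be 2 modulo
        3, and positivity makes \<open>j\<close> a natural number, so \<open>n\<close> would have
        the excluded form.\<close>
      assume R: "R \<noteq> 0"
      hence "P dvd N" and ne: "factor_pairs (N div P) \<noteq> {}" by (auto simp: R_def split: if_splits)
      then obtain y where "N = P * y" by blast
      moreover have "P \<noteq> 0" using P(2) by auto
      ultimately have y: "N = P * y" "factor_pairs y \<noteq> {}" using ne by simp_all
      then obtain d e where "(d, e) \<in> factor_pairs y" by auto
      hence "y mod 3 = 2" by (rule factor_pairs_mod_3)
      define j where "j = y div 3"
      have yj: "y = 3 * j + 2" using \<open>y mod 3 = 2\<close> unfolding j_def by presburger
      have "s * (3 * int n + int k) = s * (int p * y)" using y(1) by (simp add: N_def P_def)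
      hence eq: "3 * int n + int k = int p * y" by (simp add: s_def split: if_splits)
      hence "int p * y > 0" using k0 by linarith
      hence "y > 0" using p0 by (simp add: zero_less_mult_iff)
      hence "j \<ge> 0" using yj by linarith
      moreover have "3 * int n = 3 * (int \<beta> + int p * j)"
      proof -
        have "3 * int \<beta> + int k = 2 * int p" using k(2) by linarith
        thus ?thesis using eq unfolding yj by (simp add: algebra_simps)
      qed
      hence "int n = int (\<beta> + p * nat j)" using \<open>j \<ge> 0\<close> by simp
      ultimately show False using False of_nat_eq_iff by blast
    qed
    moreover have "fps_nth (fps_X ^ \<beta> * (Abs_fps (\<lambda>n. b9 (2 * n + 1)) oo fps_X ^ p)) n = 0"
    proof (cases "n < \<beta>")
      case ge: False
      have "\<not> p dvd n - \<beta>"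
      proof
        assume "p dvd n - \<beta>"
        then obtain j where "n - \<beta> = p * j" by blast
        hence "n = \<beta> + p * j" using ge by linarith
        thus False using False by blast
      qed
      thus ?thesis using p0 by (simp add: fps_X_power_mult_nth fps_nth_compose_X_power)
    qed (simp add: fps_X_power_mult_nth)
    ultimately show ?thesis by simp
  qed
  with L have "even (b9 (2 * p * n + \<alpha>)) \<longleftrightarrow> even (fps_nth (fps_X ^ \<beta> * (Abs_fps (\<lambda>n. b9 (2 * n + 1)) oo fps_X ^ p)) n)"
    by simp
  thus "[fps_nth (Abs_fps (\<lambda>n. b9 (2 * p * n + \<alpha>))) n
      = fps_nth (fps_X ^ \<beta> * (Abs_fps (\<lambda>n. b9 (2 * n + 1)) oo fps_X ^ p)) n] (mod 2)"
    by (simp only: cong_def fps_nth_Abs_fps mod2_eq_if)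
qed

theorem theorem2p4:
  fixes p \<alpha> \<beta> :: nat
  assumes "p \<in> {17, 19, 37}"
    and "0 < \<alpha>" and "\<alpha> < 2 * p" and "[3 * int \<alpha> = -1] (mod (2 * int p))"
    and "int \<beta> = \<lfloor>2 * real p / 3\<rfloor>"
  shows "fps_cong (Abs_fps (\<lambda>n. b9 (2 * p * n + \<alpha>)))
           (fps_X ^ \<beta> * (Abs_fps (\<lambda>n. b9 (2 * n + 1)) oo fps_X ^ p)) 2"
proof -
  have dvd: "2 * int p dvd 3 * int \<alpha> + 1"
    using assms(4) by (simp add: cong_iff_dvd_diff)
  have "2 * real p / 3 = of_nat (2 * p) / of_nat 3" by simp
  hence "\<lfloor>2 * real p / 3\<rfloor> = int (2 * p div 3)"
    by (simp only: floor_divide_of_nat_eq)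
  hence \<beta>: "\<beta> = 2 * p div 3" using assms(5) by simp
  \<comment> \<open>The congruence has one solution in the range for each prime; 3\<alpha> + 1 is
    then 2p for p = 17 and 4p for the other two, so \<open>k\<close> is 1, 2 and 2.\<close>
  consider "p = 17" "\<alpha> = 11" | "p = 19" "\<alpha> = 25" | "p = 37" "\<alpha> = 49"
  proof -
    have "p = 17 \<Longrightarrow> \<alpha> = 11" "p = 19 \<Longrightarrow> \<alpha> = 25" "p = 37 \<Longrightarrow> \<alpha> = 49"
      using assms(3) dvd by (simp; presburger)+
    thus ?thesis using assms(1) that by auto
  qed
  thus ?thesis
  proof cases
    case 1
    thus ?thesis by (intro b9_congruence[where k = 1]) (simp_all add: \<beta>)
  next
    case 2
    thus ?thesis by (intro b9_congruence[where k = 2]) (simp_all add: \<beta>)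
  next
    case 3
    thus ?thesis by (intro b9_congruence[where k = 2]) (simp_all add: \<beta>)
  qed
qed

end
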